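(* Let $q_+,q_-$ be parameters such that either $q_+=\frac{\epsilon}{M+N}$, $q_-=\frac{M-N}{M+N}$ with $M,N\in\{0,1,2,\dots\}$, $M+N\neq0$, $\epsilon\in\{1,-1\}$, or $q_+=0$, $-1\le q_-\le1$. For all $x,y,\xi,\eta\in H$, the cyclic creation and annihilation operators of type B satisfy $$\mathsf{b}_{q_+,q_-}(x\otimes y)\,\mathsf{b}^*_{q_+,q_-}(\xi\otimes\eta)=\langle x,\xi\rangle\langle y,\eta\rangle\,\mathrm{id}+q_-\langle x,\eta\rangle\langle y,\xi\rangle\,\mathrm{id}+\Gamma_{q_+}\big(|\xi\rangle\langle x|\otimes|\eta\rangle\langle y|\big),$$ where $|\xi\rangle\langle x|(\cdot)=\langle x,\cdot\rangle\xi$. Moreover $\Gamma_{q_+}(|\xi\rangle\langle x|\otimes|\eta\rangle\langle y|)=\beta_{q_+}(x\otimes y)\,\mathsf{b}^*(\xi\otimes\eta)$.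
   Context: $[\pm n]=\{\overline n,\dots,\overline1,1,\dots,n\}$ with $\overline i=-i$. $B(n)$ is the group of permutations $\sigma$ of $[\pm n]$ with $\sigma(\overline i)=\overline{\sigma(i)}$. Decompose $\sigma$ into disjoint cycles: pairs of disjoint cycles $c=(a_1\dots a_k)$, $\overline c=(\overline{a_1}\dots\overline{a_k})$ form one positive cycle of length $k$, and a cycle $c=\overline c$ of $2m$ elements is one negative cycle of length $m$. $\rho^+,\rho^-$ are the partitions of lengths of positive and negative cycles, $\|\rho\|=|\rho|-\ell(\rho)$ (size minus number of parts), and $\phi_{q_+,q_-}(\sigma)=q_+^{\|\rho^+\|+\|\rho^-\|}q_-^{\ell(\rho^-)}$ (with $0^0=1$). $H$ is the complexification of a separable real Hilbert space $H_{\mathbb R}$, with inner product linear in the second and antilinear in the first argument; $\mathcal K=H\otimes H$ and $\mathcal K_n=H^{\otimes 2n}$, with simple tensors indexed by $[\pm n]$: $x_{\overline n}\otimes\cdots\otimes x_{\overline1}\otimes x_1\otimes\cdots\otimes x_n$. $B(n)$ acts on $\mathcal K_n$ by $\sigma(x_{\overline n}\otimes\cdots\otimes x_n)=x_{\sigma(\overline n)}\otimes\cdots\otimes x_{\sigma(n)}$. $\mathcal F(\mathcal K)=\bigoplus_{n\ge0}\mathcal K_n$ is the algebraic direct sum, with $\mathcal K_0=\mathbb C\,\Omega\otimes\Omega$ spanned by a unit vector, and $\langle\cdot,\cdot\rangle_{0,0}$ is the usual (free) inner product making the $\mathcal K_n$ orthogonal. Set $P^{(n)}_{q_+,q_-}=\sum_{\sigma\in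 B(n)}\phi_{q_+,q_-}(\sigma)\sigma$ on $\mathcal K_n$ ($n\ge1$), $P^{(0)}_{q_+,q_-}=\mathrm{id}$. For $f\in\mathcal K_n$, $g\in\mathcal K_m$ put $\langle f,g\rangle_{q_+,q_-}=\delta_{n,m}\langle f,P^{(m)}_{q_+,q_-}g\rangle_{0,0}$; for the parameters considered this is a semi-inner product. $\mathsf b^*(x\otimes y)=\mathsf b^*_{q_+,q_-}(x\otimes y)$ maps $x_{\overline n}\otimes\cdots\otimes x_n$ to $x\otimes x_{\overline n}\otimes\cdots\otimes x_n\otimes y$ and $\Omega\otimes\Omega$ to $x\otimes y$. $\mathsf b_{q_+,q_-}(x\otimes y)$ is the adjoint of $\mathsf b^*_{q_+,q_-}(x\otimes y)$ with respect to $\langle\cdot,\cdot\rangle_{q_+,q_-}$. If the semi-inner product is degenerate, operators and identities involving $\mathsf b_{q_+,q_-}$ are understood on the quotient of $\mathcal F(\mathcal K)$ by the null vectors. For bounded operators $A,B$ on $H$, $\Gamma_{q_+}(A\otimes B)$ is the linear operator on $\mathcal F(\mathcal K)$ with $\Gamma_{q_+}(A\otimes B)\,\Omega\otimes\Omega=0$ and $$\Gamma_{q_+}(A\otimes B)\,x_{\overline n}\otimes\cdots\otimes x_n=q_+\sum_{i=1}^n\big(\cdots\otimes Ax_{\overline i}\otimes\cdots\otimes Bx_i\otimes\cdots\big)+q_+\sum_{i=1}^n\big(\cdots\otimes Bx_{\overline i}\otimes\cdots\otimes Ax_i\otimes\cdots\big),$$ where in each summand only the entries at positions $\overline i$ and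 $i$ are changed, to the displayed ones. $\beta_{q_+}(x\otimes y)$ maps $\mathcal K_n$ to $\mathcal K_{n-1}$ for $n\ge1$ by $\beta_{q_+}(x\otimes y)=q_+\sum_{i\in[\pm(n-1)]}\mathcal J_i(x\otimes y)$, where $\mathcal J_i(x\otimes y)(x_{\overline n}\otimes\cdots\otimes x_n)=\langle x,x_{\overline i}\rangle\langle y,x_i\rangle\,\mathcal C\big((i\,n)(\overline i\,\overline n)\cdot x_{\overline n}\otimes\cdots\otimes x_n\big)$ and $\mathcal C$ deletes the entries at positions $\overline n$ and $n$ (with $\mathcal C(x_{\overline 1}\otimes x_1)=\Omega\otimes\Omega$); for $n=1$ the sum is empty. *)

theory Defs
  imports
    "HOL-Analysis.Analysis"
    "HOL-Combinatorics.Combinatorics"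
    "HOL-Library.Function_Algebras"
begin

section \<open>Signed permutations\<close>

text \<open>\<open>pm n\<close> is the set \<open>[\<plusminus>n]\<close>; the barred index is the negated integer.\<close>

definition pm :: "nat \<Rightarrow> int set" where
  "pm n = {- int n..int n} - {0}"

definition B_group :: "nat \<Rightarrow> (int \<Rightarrow> int) set" where
  "B_group n = {\<sigma>. \<sigma> permutes pm n \<and> (\<forall>i\<in>pm n. \<sigma> (- i) = - \<sigma> i)}"

definition cycle_sets :: "nat \<Rightarrow> (int \<Rightarrow> int) \<Rightarrow> int set set" where
  "cycle_sets n \<sigma> = orbit \<sigma> ` pm n"

text \<open>
  A cycle is recorded by its support. If the supports of \<open>c\<close> and of the barred cycle are different,
  they are disjoint and the pair is one positive cycle, recorded by the union of both supports;
  a cycle equal to its barred cycle is a negative one. In both cases the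
  length is half the number of elements of the recorded set.
\<close>

definition pos_cycles :: "nat \<Rightarrow> (int \<Rightarrow> int) \<Rightarrow> int set set" where
  "pos_cycles n \<sigma> = {C \<union> uminus ` C | C. C \<in> cycle_sets n \<sigma> \<and> uminus ` C \<noteq> C}"

definition neg_cycles :: "nat \<Rightarrow> (int \<Rightarrow> int) \<Rightarrow> int set set" where
  "neg_cycles n \<sigma> = {C. C \<in> cycle_sets n \<sigma> \<and> uminus ` C = C}"

definition rho_pos :: "nat \<Rightarrow> (int \<Rightarrow> int) \<Rightarrow> nat multiset" where
  "rho_pos n \<sigma> = image_mset (\<lambda>C. card C div 2) (mset_set (pos_cycles n \<sigma>))"

definition rho_neg :: "nat \<Rightarrow> (int \<Rightarrow> int) \<Rightarrow> nat multiset" where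
  "rho_neg n \<sigma> = image_mset (\<lambda>C. card C div 2) (mset_set (neg_cycles n \<sigma>))"

definition part_norm :: "nat multiset \<Rightarrow> nat" where
  "part_norm \<rho> = sum_mset \<rho> - size \<rho>"

definition phi :: "real \<Rightarrow> real \<Rightarrow> nat \<Rightarrow> (int \<Rightarrow> int) \<Rightarrow> real" where
  "phi qp qm n \<sigma> =
     qp ^ (part_norm (rho_pos n \<sigma>) + part_norm (rho_neg n \<sigma>)) * qm ^ size (rho_neg n \<sigma>)"


section \<open>Complexification of a real inner product space\<close>

text \<open>The pair \<open>(a, b)\<close> stands for \<open>a + \<i> b\<close>.\<close>

type_synonym 'a cplx = "'a \<times> 'a"

definition cscale :: "complex \<Rightarrow> 'a::real_vector cplx \<Rightarrow> 'a cplx" where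
  "cscale c x = (Re c *\<^sub>R fst x - Im c *\<^sub>R snd x, Re c *\<^sub>R snd x + Im c *\<^sub>R fst x)"

text \<open>Antilinear in the first and linear in the second argument.\<close>

definition cinner :: "'a::real_inner cplx \<Rightarrow> 'a cplx \<Rightarrow> complex" where
  "cinner x y = Complex (fst x \<bullet> fst y + snd x \<bullet> snd y) (fst x \<bullet> snd y - snd x \<bullet> fst y)"

definition ketbra :: "'a::real_inner cplx \<Rightarrow> 'a cplx \<Rightarrow> 'a cplx \<Rightarrow> 'a cplx" where
  "ketbra \<xi> x = (\<lambda>z. cscale (cinner x z) \<xi>)"


section \<open>The tensor powers\<close>

text \<open>
  The algebraic tensor power \<open>H\<^sup>\<otimes>\<^sup>2\<^sup>n\<close>, with factors indexed by \<open>[\<plusminus>n]\<close>, is realised inside the space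
  of all functionals of \<open>y : [\<plusminus>n] \<rightarrow> H\<close>: the simple tensor of \<open>x\<close> is the functional
  \<open>y \<mapsto> \<Prod>i. \<langle>y\<^sub>i, x\<^sub>i\<rangle>\<close>, conjugate-linear in each argument, and the tensor power is the linear span
  of the simple tensors. Only the entries of \<open>x\<close> and \<open>y\<close> at indices in \<open>pm n\<close> matter, so
  the families are taken to be total functions on \<open>int\<close>. For \<open>n = 0\<close> the only simple tensor
  is the constant 1, which plays the role of \<open>\<Omega> \<otimes> \<Omega>\<close>.
\<close>

type_synonym 'a functional = "(int \<Rightarrow> 'a cplx) \<Rightarrow> complex"

definition kscale :: "complex \<Rightarrow> 'a functional \<Rightarrow> 'a functional" where
  "kscale c F = (\<lambda>y. c * F y)"

definition tens :: "nat \<Rightarrow> (int \<Rightarrow> 'a::real_inner cplx) \<Rightarrow> 'a functional" where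
  "tens n x = (\<lambda>y. \<Prod>i\<in>pm n. cinner (y i) (x i))"

definition tensor_power :: "nat \<Rightarrow> 'a::real_inner functional set" where
  "tensor_power n = module.span kscale (range (tens n))"

text \<open>The sesquilinear form on \<open>tensor_power n\<close> determined by its values on simple tensors.\<close>

definition free_inner :: "nat \<Rightarrow> 'a::real_inner functional \<Rightarrow> 'a functional \<Rightarrow> complex" where
  "free_inner n F G = (THE c. \<exists>S a T b. finite S \<and> finite T \<and>
     F = (\<Sum>x\<in>S. kscale (a x) (tens n x)) \<and> G = (\<Sum>y\<in>T. kscale (b y) (tens n y)) \<and>
     c = (\<Sum>x\<in>S. \<Sum>y\<in>T. cnj (a x) * b y * (\<Prod>i\<in>pm n. cinner (x i) (y i))))"

text \<open>
  \<open>lin_ext n g\<close> is a linear map with \<open>tens n x \<mapsto> g x\<close>. It is unique on \<open>tensor_power n\<close>, and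
  its values elsewhere are irrelevant.
\<close>

definition lin_ext ::
  "nat \<Rightarrow> ((int \<Rightarrow> 'a::real_inner cplx) \<Rightarrow> 'a functional) \<Rightarrow> 'a functional \<Rightarrow> 'a functional" where
  "lin_ext n g = (SOME T. Vector_Spaces.linear kscale kscale T \<and> (\<forall>x. T (tens n x) = g x))"

definition act :: "nat \<Rightarrow> (int \<Rightarrow> int) \<Rightarrow> 'a::real_inner functional \<Rightarrow> 'a functional" where
  "act n \<sigma> = lin_ext n (\<lambda>x. tens n (x \<circ> \<sigma>))"

definition P_op :: "real \<Rightarrow> real \<Rightarrow> nat \<Rightarrow> 'a::real_inner functional \<Rightarrow> 'a functional" where
  "P_op qp qm n F = (if n = 0 then F
     else (\<Sum>\<sigma>\<in>B_group n. kscale (complex_of_real (phi qp qm n \<sigma>)) (act n \<sigma> F)))"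


section \<open>The Fock space and its operators\<close>

type_synonym 'a graded = "nat \<Rightarrow> 'a functional"

definition fscale :: "complex \<Rightarrow> 'a graded \<Rightarrow> 'a graded" where
  "fscale c f = (\<lambda>n. kscale c (f n))"

definition fock :: "'a::real_inner graded set" where
  "fock = {f. (\<forall>n. f n \<in> tensor_power n) \<and> finite {n. f n \<noteq> 0}}"

definition fock_inner ::
  "real \<Rightarrow> real \<Rightarrow> 'a::real_inner graded \<Rightarrow> 'a graded \<Rightarrow> complex" where
  "fock_inner qp qm f g =
     (\<Sum>n | f n \<noteq> 0 \<and> g n \<noteq> 0. free_inner n (f n) (P_op qp qm n (g n)))"

text \<open>Equality in the quotient by the null vectors, i.e. the vectors of length 0.\<close>

definition null_eq :: "real \<Rightarrow> real \<Rightarrow> 'a::real_inner graded \<Rightarrow> 'a graded \<Rightarrow> bool" where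
  "null_eq qp qm f g \<longleftrightarrow> fock_inner qp qm (f - g) (f - g) = 0"

text \<open>The new entries are placed at the positions \<open>-(n+1)\<close> and \<open>n+1\<close>.\<close>

definition creation ::
  "'a::real_inner cplx \<Rightarrow> 'a cplx \<Rightarrow> 'a graded \<Rightarrow> 'a graded" where
  "creation x y f = (\<lambda>m. case m of 0 \<Rightarrow> 0
     | Suc n \<Rightarrow> lin_ext n (\<lambda>z. tens (Suc n) (z(- int (Suc n) := x, int (Suc n) := y))) (f n))"

text \<open>\<open>T\<close> is an adjoint of \<open>S\<close>.\<close>

definition is_adjoint ::
  "real \<Rightarrow> real \<Rightarrow> ('a::real_inner graded \<Rightarrow> 'a graded) \<Rightarrow> ('a graded \<Rightarrow> 'a graded) \<Rightarrow> bool" where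
  "is_adjoint qp qm S T \<longleftrightarrow>
     Vector_Spaces.linear fscale fscale T \<and> (\<forall>f\<in>fock. T f \<in> fock) \<and>
     (\<forall>f\<in>fock. \<forall>g\<in>fock. fock_inner qp qm (T f) g = fock_inner qp qm f (S g))"

text \<open>
  The adjoint is given on representatives; on \<open>fock\<close> it is determined up to null vectors.
\<close>

definition annihilation ::
  "real \<Rightarrow> real \<Rightarrow> 'a::real_inner cplx \<Rightarrow> 'a cplx \<Rightarrow> 'a graded \<Rightarrow> 'a graded" where
  "annihilation qp qm x y = (SOME T. is_adjoint qp qm (creation x y) T)"

text \<open>For \<open>n = 0\<close> the sums are empty, so that \<open>\<Omega> \<otimes> \<Omega>\<close> is mapped to 0.\<close>

definition Gamma_op ::
  "real \<Rightarrow> ('a::real_inner cplx \<Rightarrow> 'a cplx) \<Rightarrow> ('a cplx \<Rightarrow> 'a cplx) \<Rightarrow> 'a graded \<Rightarrow> 'a graded" where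
  "Gamma_op qp A B f = (\<lambda>n. lin_ext n (\<lambda>x.
     kscale (complex_of_real qp) (\<Sum>i=1..int n. tens n (x(- i := A (x (- i)), i := B (x i)))) +
     kscale (complex_of_real qp) (\<Sum>i=1..int n. tens n (x(- i := B (x (- i)), i := A (x i))))) (f n))"

text \<open>
  \<open>beta_J n x y i\<close> is \<open>\<J>\<^sub>i\<close> on \<open>\<K>\<^sub>n\<^sub>+\<^sub>1\<close>. Passing from \<open>tens (Suc n)\<close> to \<open>tens n\<close> deletes the
  entries at the positions \<open>-(n+1)\<close> and \<open>n+1\<close>.
\<close>

definition beta_J :: "nat \<Rightarrow> 'a::real_inner cplx \<Rightarrow> 'a cplx \<Rightarrow> int \<Rightarrow> 'a functional \<Rightarrow> 'a functional"
  where
  "beta_J n x y i = lin_ext (Suc n) (\<lambda>z.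
     kscale (cinner x (z (- i)) * cinner y (z i))
       (tens n (z \<circ> (Transposition.transpose i (int (Suc n)) \<circ>
                     Transposition.transpose (- i) (- int (Suc n))))))"

text \<open>The component of degree 0 is mapped to 0.\<close>

definition beta_op :: "real \<Rightarrow> 'a::real_inner cplx \<Rightarrow> 'a cplx \<Rightarrow> 'a graded \<Rightarrow> 'a graded" where
  "beta_op qp x y f = (\<lambda>n. kscale (complex_of_real qp) (\<Sum>i\<in>pm n. beta_J n x y i (f (Suc n))))"


section \<open>Values on simple tensors\<close>

text \<open>
  The operators and the form above are indeed well defined: they take the prescribed values on
  simple tensors.
\<close>

lemma vector_space_kscale: "vector_space kscale"
  by unfold_locales (auto simp: kscale_def fun_eq_iff algebra_simps)

lemma linear_kscaleI:
  assumes "\<And>F G. T (F + G) = T F + T G" "\<And>c F. T (kscale c F) = kscale c (T F)"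
  shows "Vector_Spaces.linear kscale kscale T"
  using assms
  by (simp add: Vector_Spaces.linear_def module_hom_def module_hom_axioms_def
      module_iff_vector_space vector_space_kscale)

lemma lin_ext_spec:
  assumes "Vector_Spaces.linear kscale kscale T" "\<And>x. T (tens n x) = g x"
  shows "Vector_Spaces.linear kscale kscale (lin_ext n g)" "lin_ext n g (tens n x) = g x"
proof -
  have "Vector_Spaces.linear kscale kscale (lin_ext n g) \<and> (\<forall>x. lin_ext n g (tens n x) = g x)"
    unfolding lin_ext_def by (rule someI[of _ T]) (use assms in auto)
  then show "Vector_Spaces.linear kscale kscale (lin_ext n g)" "lin_ext n g (tens n x) = g x"
    by auto
qed

lemma finite_pm [simp]: "finite (pm n)"
  by (simp add: pm_def)

lemma pm_Suc: "pm (Suc n) = insert (- int (Suc n)) (insert (int (Suc n)) (pm n))"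
  by (auto simp: pm_def)

lemma cinner_commute: "cinner y x = cnj (cinner x y)"
  by (simp add: cinner_def complex_eq_iff inner_commute)

lemma cinner_add_right: "cinner x (y + z) = cinner x y + cinner x z"
  by (simp add: cinner_def complex_eq_iff inner_simps)

lemma cinner_cscale_right: "cinner x (cscale c y) = c * cinner x y"
  by (simp add: cinner_def cscale_def complex_eq_iff inner_simps algebra_simps)

lemma cinner_ketbra: "cinner y (ketbra \<xi> x z) = cinner (ketbra x \<xi> y) z"
  by (simp add: ketbra_def cinner_cscale_right cinner_commute[of "cscale _ _"])
     (simp add: cinner_commute[of y] cinner_commute[of z])

lemma tens_remove2:
  assumes "i \<in> pm n"
  shows "tens n x y = cinner (y (- i)) (x (- i)) * cinner (y i) (x i) *
           (\<Prod>j\<in>pm n - {i, - i}. cinner (y j) (x j))"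
proof -
  have *: "pm n = insert (- i) (insert i (pm n - {i, - i}))" "i \<noteq> - i"
    using assms by (auto simp: pm_def)
  show ?thesis unfolding tens_def by (subst *(1)) (use *(2) in auto)
qed

lemma tens_upd2:
  assumes "i \<in> pm n"
  shows "tens n (x(- i := a, i := b)) y = cinner (y (- i)) a * cinner (y i) b *
           (\<Prod>j\<in>pm n - {i, - i}. cinner (y j) (x j))"
proof -
  have "i \<noteq> - i" using assms by (auto simp: pm_def)
  then show ?thesis by (subst tens_remove2[OF assms]) (auto intro!: prod.cong)
qed

lemma free_inner_sum_tens:
  fixes a b :: "(int \<Rightarrow> 'a::real_inner cplx) \<Rightarrow> complex"
  assumes "finite S" "finite T"
  shows "free_inner n (\<Sum>x\<in>S. kscale (a x) (tens n x)) (\<Sum>y\<in>T. kscale (b y) (tens n y)) =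
           (\<Sum>x\<in>S. \<Sum>y\<in>T. cnj (a x) * b y * (\<Prod>i\<in>pm n. cinner (x i) (y i)))"
proof -
  define val where "val S a T b =
    (\<Sum>x\<in>S. \<Sum>y\<in>T. cnj (a x) * b y * (\<Prod>i\<in>pm n. cinner (x i) (y i)))"
    for S T :: "(int \<Rightarrow> 'a cplx) set" and a b
  have appl: "(\<Sum>x\<in>S. h x) z = (\<Sum>x\<in>S. h x z)"
    for S :: "(int \<Rightarrow> 'a cplx) set" and h :: "_ \<Rightarrow> 'a functional" and z
    by (induction S rule: infinite_finite_induct) auto
  have val1: "val S a T b = (\<Sum>x\<in>S. cnj (a x) * (\<Sum>y\<in>T. kscale (b y) (tens n y)) x)" for S a T b
    by (simp add: val_def appl kscale_def tens_def sum_distrib_left mult.assoc)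
  have val2: "val S a T b = (\<Sum>y\<in>T. b y * cnj ((\<Sum>x\<in>S. kscale (a x) (tens n x)) y))" for S a T b
    unfolding val_def
    by (subst sum.swap)
      (simp add: appl kscale_def tens_def sum_distrib_left cinner_commute[symmetric] mult_ac)
  show ?thesis
    unfolding free_inner_def val_def[symmetric]
  proof (rule the_equality)
    show "\<exists>S' a' T' b'. finite S' \<and> finite T' \<and>
      (\<Sum>x\<in>S. kscale (a x) (tens n x)) = (\<Sum>x\<in>S'. kscale (a' x) (tens n x)) \<and>
      (\<Sum>y\<in>T. kscale (b y) (tens n y)) = (\<Sum>y\<in>T'. kscale (b' y) (tens n y)) \<and>
      val S a T b = val S' a' T' b'"
      using assms by blast
  next
    fix c
    assume "\<exists>S' a' T' b'. finite S' \<and> finite T' \<and>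
      (\<Sum>x\<in>S. kscale (a x) (tens n x)) = (\<Sum>x\<in>S'. kscale (a' x) (tens n x)) \<and>
      (\<Sum>y\<in>T. kscale (b y) (tens n y)) = (\<Sum>y\<in>T'. kscale (b' y) (tens n y)) \<and>
      c = val S' a' T' b'"
    then obtain S' a' T' b' where
      eq: "(\<Sum>x\<in>S. kscale (a x) (tens n x)) = (\<Sum>x\<in>S'. kscale (a' x) (tens n x))"
        "(\<Sum>y\<in>T. kscale (b y) (tens n y)) = (\<Sum>y\<in>T'. kscale (b' y) (tens n y))"
      and c: "c = val S' a' T' b'"
      by blast
    have "c = val S' a' T b" unfolding c val1 eq(2) ..
    also have "\<dots> = val S a T b" unfolding val2 eq(1) ..
    finally show "c = val S a T b" .
  qed
qed

lemma free_inner_tens: "free_inner n (tens n x) (tens n y) = (\<Prod>i\<in>pm n. cinner (x i) (y i))"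
  using free_inner_sum_tens[of "{x}" "{y}" n "\<lambda>_. 1" "\<lambda>_. 1"] by (simp add: kscale_def)

lemma act_tens:
  fixes x :: "int \<Rightarrow> 'a::real_inner cplx"
  assumes "\<sigma> \<in> B_group n"
  shows "Vector_Spaces.linear kscale kscale (act n \<sigma> :: 'a functional \<Rightarrow> _)" "act n \<sigma> (tens n x) = tens n (x \<circ> \<sigma>)"
proof -
  have p: "\<sigma> permutes pm n" using assms by (simp add: B_group_def)
  define T where "T F = (\<lambda>y. F (y \<circ> inv \<sigma>))" for F :: "'a functional"
  have "Vector_Spaces.linear kscale kscale T"
    by (rule linear_kscaleI) (auto simp: T_def kscale_def)
  moreover have "T (tens n x) = tens n (x \<circ> \<sigma>)" for x
    unfolding T_def tens_def
    by (rule ext, subst prod.permute[OF p]) (simp add: o_def permutes_inverses[OF p])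
  ultimately show "Vector_Spaces.linear kscale kscale (act n \<sigma> :: 'a functional \<Rightarrow> _)"
    "act n \<sigma> (tens n x) = tens n (x \<circ> \<sigma>)"
    unfolding act_def by - (erule lin_ext_spec, blast)+
qed

lemma creation_ext:
  defines "g \<equiv> \<lambda>n (x::'a::real_inner cplx) y z. tens (Suc n) (z(- int (Suc n) := x, int (Suc n) := y))"
  shows "Vector_Spaces.linear kscale kscale (lin_ext n (g n x y))"
    "lin_ext n (g n x y) (tens n z) = g n x y z"
proof -
  define T where "T F = (\<lambda>w. cinner (w (- int (Suc n))) x * cinner (w (int (Suc n))) y * F w)"
    for F :: "'a functional"
  have "Vector_Spaces.linear kscale kscale T"
    by (rule linear_kscaleI) (auto simp: T_def kscale_def algebra_simps)
  moreover have "T (tens n z) = g n x y z" for z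
  proof (rule ext)
    fix w
    have "pm (Suc n) - {int (Suc n), - int (Suc n)} = pm n" by (auto simp: pm_def)
    moreover have "int (Suc n) \<in> pm (Suc n)" by (simp add: pm_def)
    ultimately show "T (tens n z) w = g n x y z w"
      unfolding T_def g_def by (subst tens_upd2) (simp_all add: tens_def)
  qed
  ultimately show "Vector_Spaces.linear kscale kscale (lin_ext n (g n x y))"
    "lin_ext n (g n x y) (tens n z) = g n x y z"
    by - (erule lin_ext_spec, blast)+
qed

lemma Gamma_ext:
  fixes x y \<xi> \<eta> :: "'a::real_inner cplx" and qp :: real
  defines "A \<equiv> ketbra \<xi> x" and "B \<equiv> ketbra \<eta> y"
  defines "g \<equiv> \<lambda>n z.
     kscale (complex_of_real qp) (\<Sum>i=1..int n. tens n (z(- i := A (z (- i)), i := B (z i)))) +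
     kscale (complex_of_real qp) (\<Sum>i=1..int n. tens n (z(- i := B (z (- i)), i := A (z i))))"
  shows "Vector_Spaces.linear kscale kscale (lin_ext n (g n))"
    "lin_ext n (g n) (tens n z) = g n z"
proof -
  define A' B' where "A' = ketbra x \<xi>" and "B' = ketbra y \<eta>"
  define T where "T F = (\<lambda>w. complex_of_real qp *
     (\<Sum>i=1..int n. F (w(- i := A' (w (- i)), i := B' (w i)))) + complex_of_real qp *
     (\<Sum>i=1..int n. F (w(- i := B' (w (- i)), i := A' (w i)))))" for F :: "'a functional"
  have appl: "(\<Sum>i\<in>S. h i) w = (\<Sum>i\<in>S. h i w)"
    for S :: "int set" and h :: "int \<Rightarrow> 'a functional" and w
    by (induction S rule: infinite_finite_induct) auto
  have upd: "tens n z (w(- i := ketbra a b (w (- i)), i := ketbra c d (w i))) =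
      tens n (z(- i := ketbra b a (z (- i)), i := ketbra d c (z i))) w"
    if "i \<in> {1..int n}" for i z w and a b c d :: "'a cplx"
  proof -
    have i: "i \<in> pm n" "i \<noteq> - i" using that by (auto simp: pm_def)
    show ?thesis
      using i(2)
      by (subst tens_remove2[OF i(1)], subst tens_upd2[OF i(1)])
        (auto simp: cinner_ketbra intro!: prod.cong)
  qed
  have "Vector_Spaces.linear kscale kscale T"
    by (rule linear_kscaleI)
      (auto simp: T_def kscale_def algebra_simps sum.distrib sum_distrib_left)
  moreover have "T (tens n z) = g n z" for z
    by (rule ext) (simp add: T_def g_def A'_def B'_def A_def B_def appl kscale_def upd
        del: One_nat_def cong: sum.cong_simp)
  ultimately show "Vector_Spaces.linear kscale kscale (lin_ext n (g n))"
    "lin_ext n (g n) (tens n z) = g n z"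
    by - (erule lin_ext_spec, blast)+
qed

lemma beta_J_tens:
  fixes x y :: "'a::real_inner cplx"
  assumes "i \<in> pm n"
  shows "Vector_Spaces.linear kscale kscale (beta_J n x y i)"
    "beta_J n x y i (tens (Suc n) z) = kscale (cinner x (z (- i)) * cinner y (z i))
       (tens n (z \<circ> (Transposition.transpose i (int (Suc n)) \<circ>
                     Transposition.transpose (- i) (- int (Suc n)))))"
proof -
  let ?N = "int (Suc n)"
  let ?t = "Transposition.transpose i ?N \<circ> Transposition.transpose (- i) (- ?N)"
  define T where "T F = (\<lambda>w. F (w(- i := x, i := y, - ?N := w (- i), ?N := w i)))"
    for F :: "'a functional"
  have i: "- i \<in> pm n" "i \<noteq> - i" "?N \<noteq> i" "?N \<noteq> - i" "- ?N \<noteq> i" "?N \<noteq> 0"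
    using assms by (auto simp: pm_def)
  have "Vector_Spaces.linear kscale kscale T"
    by (rule linear_kscaleI) (auto simp: T_def kscale_def)
  moreover have "T (tens (Suc n) z) =
      kscale (cinner x (z (- i)) * cinner y (z i)) (tens n (z \<circ> ?t))" for z
  proof (rule ext)
    fix w
    let ?w = "w(- i := x, i := y, - ?N := w (- i), ?N := w i)"
    have N: "?N \<in> pm (Suc n)" by (simp add: pm_def)
    have D: "pm (Suc n) - {?N, - ?N} = pm n" by (auto simp: pm_def)
    have "T (tens (Suc n) z) w = cinner (w (- i)) (z (- ?N)) * cinner (w i) (z ?N) *
        (\<Prod>j\<in>pm n. cinner (?w j) (z j))"
      unfolding T_def by (subst tens_remove2[OF N], subst D) simp
    also have "(\<Prod>j\<in>pm n. cinner (?w j) (z j)) = tens n z (w(- i := x, i := y))"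
      unfolding tens_def by (rule prod.cong) (auto simp: pm_def)
    also have "\<dots> = cinner x (z (- i)) * cinner y (z i) *
        (\<Prod>j\<in>pm n - {i, - i}. cinner (w j) (z j))"
      using i(2) by (subst tens_remove2[OF assms]) (auto intro!: prod.cong)
    finally have 1: "T (tens (Suc n) z) w = \<dots> * (cinner (w (- i)) (z (- ?N)) * cinner (w i) (z ?N))"
      by (simp add: mult_ac)
    have t: "?t i = ?N" "?t (- i) = - ?N" using i by (auto simp: Transposition.transpose_def)
    have t': "?t j = j" if "j \<in> pm n - {i, - i}" for j
      using that by (auto simp: Transposition.transpose_def pm_def)
    have 2: "tens n (z \<circ> ?t) w = cinner (w (- i)) (z (- ?N)) * cinner (w i) (z ?N) *
        (\<Prod>j\<in>pm n - {i, - i}. cinner (w j) (z j))"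
      using t t' by (subst tens_remove2[OF assms]) (auto intro!: prod.cong)
    show "T (tens (Suc n) z) w =
        kscale (cinner x (z (- i)) * cinner y (z i)) (tens n (z \<circ> ?t)) w"
      by (simp only: 1 2 kscale_def mult_ac)
  qed
  ultimately show "Vector_Spaces.linear kscale kscale (beta_J n x y i)"
    "beta_J n x y i (tens (Suc n) z) =
      kscale (cinner x (z (- i)) * cinner y (z i)) (tens n (z \<circ> ?t))"
    unfolding beta_J_def by - (erule lin_ext_spec, blast)+
qed

end

theory Submission
  imports Defs
begin

text \<open>
  Every element of \<open>B(n+1)\<close> is uniquely \<open>\<sigma> \<circ> t\<^sub>i\<close> with \<open>\<sigma> \<in> B(n)\<close> and \<open>i \<in> [\<plusminus>(n+1)]\<close>, where the
  involution \<open>t\<^sub>i\<close> exchanges \<open>i\<close> with \<open>n+1\<close> and \<open>-i\<close> with \<open>-(n+1)\<close>. Passing from \<open>\<sigma>\<close> to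
  \<open>\<sigma> \<circ> t\<^sub>i\<close> adds a positive fixed point if \<open>i = n+1\<close>, adds a negative cycle of length 1 if
  \<open>i = -(n+1)\<close>, and otherwise lengthens the cycle of \<open>i\<close> by one without changing its sign. So
  the weight is multiplied by 1, \<open>q\<^sub>-\<close> or \<open>q\<^sub>+\<close>, and \<open>P\<^sup>(\<^sup>n\<^sup>+\<^sup>1\<^sup>)\<close> factors through \<open>P\<^sup>(\<^sup>n\<^sup>)\<close>. This gives
  an explicit adjoint of \<open>b\<^sup>*(x \<otimes> y)\<close>: the free contraction, plus \<open>q\<^sub>-\<close> times the flipped free
  contraction, plus \<open>\<beta>(x \<otimes> y)\<close>. The identity is then read off on simple tensors. Any two
  adjoints differ by a vector orthogonal to the whole Fock space, hence by a null vector, which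
  settles the chosen adjoint.
\<close>

section \<open>Cycles of signed permutations\<close>

lemma uminus_mem_pm [simp]: "- i \<in> pm n \<longleftrightarrow> i \<in> pm n" for i :: int
  by (auto simp: pm_def)

lemma zero_notin_pm [simp]: "0 \<notin> pm n"
  by (simp add: pm_def)

lemma pm_neq_last:
  assumes "i \<in> pm n"
  shows "i \<noteq> int (Suc n)" "i \<noteq> - int (Suc n)"
  using assms by (auto simp: pm_def)

lemma B_group_permutes: "\<sigma> \<in> B_group n \<Longrightarrow> \<sigma> permutes pm n"
  by (simp add: B_group_def)

lemma B_group_uminus: "\<sigma> \<in> B_group n \<Longrightarrow> \<sigma> (- i) = - \<sigma> i"
  by (cases "i \<in> pm n") (auto simp: B_group_def permutes_not_in)

lemma B_groupI: "\<sigma> permutes pm n \<Longrightarrow> (\<And>i. \<sigma> (- i) = - \<sigma> i) \<Longrightarrow> \<sigma> \<in> B_group n"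
  by (simp add: B_group_def)

lemma B_group_comp: "\<sigma> \<in> B_group n \<Longrightarrow> \<tau> \<in> B_group n \<Longrightarrow> \<sigma> \<circ> \<tau> \<in> B_group n"
  by (rule B_groupI) (auto simp: B_group_permutes B_group_uminus permutes_compose)

lemma finite_B_group [simp]: "finite (B_group n)"
  by (rule finite_subset[OF _ finite_permutations[OF finite_pm[of n]]]) (auto simp: B_group_def)

lemma B_group_Suc: "\<sigma> \<in> B_group n \<Longrightarrow> \<sigma> \<in> B_group (Suc n)"
  by (rule B_groupI) (auto simp: B_group_uminus pm_Suc intro: permutes_subset[OF B_group_permutes])

text \<open>By oddness a fixed point \<open>n+1\<close> forces the fixed point
  \<open>-(n+1)\<close>, so the support shrinks to \<open>pm n\<close>. This brings the first factor
  of the factorisation into \<open>B(n)\<close>.\<close>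

lemma B_group_fix:
  assumes "\<sigma> \<in> B_group (Suc n)" "\<sigma> (int (Suc n)) = int (Suc n)"
  shows "\<sigma> \<in> B_group n"
proof (rule B_groupI)
  show "\<sigma> (- i) = - \<sigma> i" for i using assms(1) by (rule B_group_uminus)
  have "\<sigma> (- int (Suc n)) = - int (Suc n)" using B_group_uminus[OF assms(1)] assms(2) by metis
  then show "\<sigma> permutes pm n"
    using permutes_superset[OF B_group_permutes[OF assms(1)], of "pm n"] assms(2)
    by (auto simp: pm_Suc)
qed

lemma B_group_0: "B_group 0 = {id}"
  by (auto simp: B_group_def pm_def permutes_id)

lemma phi_0: "phi qp qm 0 \<sigma> = 1"
  by (simp add: phi_def rho_pos_def rho_neg_def pos_cycles_def neg_cycles_def cycle_sets_def
      pm_def part_norm_def)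

section \<open>Weights as sums over cycles\<close>

lemma part_norm_image_mset_set:
  assumes "finite A" "\<And>C. C \<in> A \<Longrightarrow> f C \<ge> 1"
  shows "part_norm (image_mset f (mset_set A)) = (\<Sum>C\<in>A. f C - 1)"
  \<comment> \<open>All parts are at least 1, so the truncated subtraction may be carried out
    termwise.\<close>
  using assms by (simp add: part_norm_def sum_unfold_sum_mset[symmetric] sum_subtractf_nat)

lemma pos_cycles_eq:
  "pos_cycles n \<sigma> = (\<lambda>C. C \<union> uminus ` C) ` {C \<in> cycle_sets n \<sigma>. uminus ` C \<noteq> C}"
  by (auto simp: pos_cycles_def)

text \<open>A locale, because the facts about cycles are used for \<open>\<sigma>\<close> in degree
  \<open>n\<close> and again for the modified permutation in degree \<open>n+1\<close>.\<close>

locale signed_perm =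
  fixes n :: nat and \<sigma> :: "int \<Rightarrow> int"
  assumes B: "\<sigma> \<in> B_group n"
begin

lemma perm: "permutation \<sigma>"
  unfolding permutation_permutes using B_group_permutes[OF B] finite_pm by blast

lemma self_in_orbit: "a \<in> orbit \<sigma> a"
  by (rule permutation_self_in_orbit[OF perm])

lemma orbit_eq: "b \<in> orbit \<sigma> a \<Longrightarrow> orbit \<sigma> b = orbit \<sigma> a"
  by (rule orbit_cyclic_eq3[OF cyclic_on_orbit'[OF perm]])

text \<open>Negation commutes with \<open>\<sigma>\<close> and hence carries orbits to
  orbits.\<close>

lemma uminus_orbit: "uminus ` orbit \<sigma> a = orbit \<sigma> (- a)"
  by (rule orbit_inverse[OF self_in_orbit]) (simp add: B_group_uminus[OF B])

lemma orbit_subset_pm: "a \<in> pm n \<Longrightarrow> orbit \<sigma> a \<subseteq> pm n"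
  by (rule permutes_orbit_subset[OF B_group_permutes[OF B]])

lemma finite_cycle_sets: "finite (cycle_sets n \<sigma>)"
  by (simp add: cycle_sets_def)

lemma finite_pos_cycles: "finite (pos_cycles n \<sigma>)"
  using finite_cycle_sets by (simp add: pos_cycles_eq)

lemma finite_neg_cycles: "finite (neg_cycles n \<sigma>)"
  using finite_cycle_sets by (simp add: neg_cycles_def)

lemma cycle_subset_pm: "C \<in> cycle_sets n \<sigma> \<Longrightarrow> C \<subseteq> pm n"
  using orbit_subset_pm by (auto simp: cycle_sets_def)

lemma cycles_subset:
  assumes "C \<in> pos_cycles n \<sigma> \<union> neg_cycles n \<sigma>"
  shows "C \<subseteq> pm n"
proof -
  have "uminus ` D \<subseteq> pm n" if "D \<subseteq> pm n" for D using that by auto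
  then show ?thesis 
    using assms cycle_subset_pm unfolding pos_cycles_def neg_cycles_def by blast
qed

lemma cycles_uminus:
  assumes "C \<in> pos_cycles n \<sigma> \<union> neg_cycles n \<sigma>"
  shows "uminus ` C = C"
proof -
  consider D where "C = D \<union> uminus ` D" | "uminus ` C = C"
    using assms unfolding pos_cycles_def neg_cycles_def by auto
  then show ?thesis
  proof cases
    case 1
    have "uminus ` uminus ` D = D" by (simp add: image_image)
    then show ?thesis unfolding 1 image_Un by (simp only: Un_commute)
  qed
qed

text \<open>A recorded set is nonempty, avoids 0 and is closed under negation, so it contains two
  different elements \<open>c\<close> and \<open>- c\<close>.\<close>

lemma cycles_length: assumes "C \<in> pos_cycles n \<sigma> \<union> neg_cycles n \<sigma>" shows "card C div 2 \<ge> 1"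
proof -
  have "C \<noteq> {}"
    using assms self_in_orbit unfolding pos_cycles_def neg_cycles_def cycle_sets_def by blast
  then obtain c where c: "c \<in> C" by blast
  then have c': "- c \<in> C" using cycles_uminus[OF assms] by blast
  have "c \<noteq> 0" using c cycles_subset[OF assms] by auto
  then have "card {c, - c} = 2" by (simp add: card_insert_if)
  moreover have "card {c, - c} \<le> card C"
    using c c' cycles_subset[OF assms] finite_subset[OF _ finite_pm] by (intro card_mono) auto
  ultimately show ?thesis by simp
qed

text \<open>The form in which the effect of one more letter is visible: the exponent of
  \<open>qp\<close> is the total of length minus one over all recorded cycles.\<close>

lemma phi_eq:
  "phi qp qm n \<sigma> = qp ^ ((\<Sum>C\<in>pos_cycles n \<sigma>. card C div 2 - 1) + (\<Sum>C\<in>neg_cycles n \<sigma>. card C div 2 - 1))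
     * qm ^ card (neg_cycles n \<sigma>)"
  unfolding phi_def rho_pos_def rho_neg_def
  using part_norm_image_mset_set[OF finite_pos_cycles cycles_length]
    part_norm_image_mset_set[OF finite_neg_cycles cycles_length]
  by simp

text \<open>A cycle through \<open>i\<close> must be the orbit of \<open>i\<close>. Together with
  the positive counterpart below, this shows that exactly one recorded set contains
  \<open>i\<close>.\<close>

lemma neg_cycles_containing:
  assumes "i \<in> pm n"
  shows "{C \<in> neg_cycles n \<sigma>. i \<in> C} = (if orbit \<sigma> (- i) = orbit \<sigma> i then {orbit \<sigma> i} else {})"
proof -
  have "C = orbit \<sigma> i \<and> orbit \<sigma> (- i) = orbit \<sigma> i" 
    if C: "C \<in> neg_cycles n \<sigma>" "i \<in> C" for C
  proof -
    obtain a where a: "C = orbit \<sigma> a" "uminus ` C = C"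
      using C unfolding neg_cycles_def cycle_sets_def by blast
    then have "orbit \<sigma> i = C" using C orbit_eq by simp
    then show ?thesis using a(2) uminus_orbit[of i] by simp
  qed
  moreover have "orbit \<sigma> i \<in> neg_cycles n \<sigma>" if "orbit \<sigma> (- i) = orbit \<sigma> i"
    using that assms by (simp add: neg_cycles_def cycle_sets_def uminus_orbit)
  ultimately show ?thesis using self_in_orbit by auto
qed

text \<open>In a positive cycle the element \<open>i\<close> may lie in either half of the pair. In
  both cases the halves are the orbits of \<open>i\<close> and \<open>- i\<close>, possibly in
  exchanged order.\<close>

lemma pos_cycles_containing:
  assumes "i \<in> pm n"
  shows "{C \<in> pos_cycles n \<sigma>. i \<in> C} =
    (if orbit \<sigma> (- i) = orbit \<sigma> i then {} else {orbit \<sigma> i \<union> orbit \<sigma> (- i)})"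
proof -
  have sub: "C = orbit \<sigma> i \<union> orbit \<sigma> (- i) \<and> orbit \<sigma> (- i) \<noteq> orbit \<sigma> i"
    if C: "C \<in> pos_cycles n \<sigma>" "i \<in> C" for C
  proof -
    obtain a where a: "C = orbit \<sigma> a \<union> orbit \<sigma> (- a)" "orbit \<sigma> (- a) \<noteq> orbit \<sigma> a"
    proof -
      obtain D where D: "C = D \<union> uminus ` D" "D \<in> cycle_sets n \<sigma>" "uminus ` D \<noteq> D"
        using C(1) unfolding pos_cycles_def by blast
      then obtain a where a: "D = orbit \<sigma> a" unfolding cycle_sets_def by blast
      show thesis by (rule that[of a]) (use D in \<open>simp_all only: a uminus_orbit not_False_eq_True\<close>)
    qed
    have "i \<in> orbit \<sigma> a \<or> i \<in> orbit \<sigma> (- a)" using C(2) unfolding a(1) by (rule UnE) blast+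
    then show ?thesis
    proof
      assume "i \<in> orbit \<sigma> a"
      then have i: "orbit \<sigma> i = orbit \<sigma> a" by (rule orbit_eq)
      have "orbit \<sigma> (- i) = orbit \<sigma> (- a)" by (simp only: uminus_orbit[symmetric] i)
      with i a show ?thesis by (simp only: not_False_eq_True simp_thms)
    next
      assume "i \<in> orbit \<sigma> (- a)"
      then have i: "orbit \<sigma> i = orbit \<sigma> (- a)" by (rule orbit_eq)
      have "orbit \<sigma> (- i) = uminus ` orbit \<sigma> (- a)" by (simp only: uminus_orbit[symmetric] i)
      then have "orbit \<sigma> (- i) = orbit \<sigma> a" by (simp only: uminus_orbit minus_minus)
      with i a show ?thesis by (metis Un_commute)
    qed
  qed
  have mem: "orbit \<sigma> i \<union> orbit \<sigma> (- i) \<in> pos_cycles n \<sigma>" if "orbit \<sigma> (- i) \<noteq> orbit \<sigma> i"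
  proof -
    have "orbit \<sigma> i \<in> {C \<in> cycle_sets n \<sigma>. uminus ` C \<noteq> C}"
      using that assms by (simp add: cycle_sets_def uminus_orbit)
    then show ?thesis unfolding pos_cycles_eq uminus_orbit[symmetric] by (rule imageI)
  qed
  show ?thesis
  proof (cases "orbit \<sigma> (- i) = orbit \<sigma> i")
    case True
    then have "{C \<in> pos_cycles n \<sigma>. i \<in> C} = {}" using sub by blast
    then show ?thesis using True by (simp only: refl if_True)
  next
    case False
    have "i \<in> orbit \<sigma> i \<union> orbit \<sigma> (- i)" using self_in_orbit by (rule UnI1)
    then have "{C \<in> pos_cycles n \<sigma>. i \<in> C} = {orbit \<sigma> i \<union> orbit \<sigma> (- i)}"
      using sub mem[OF False] by blast
    then show ?thesis using False by (simp only: refl if_False)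
  qed
qed

lemma fixes_last: "\<sigma> (int (Suc n)) = int (Suc n)" "\<sigma> (- int (Suc n)) = - int (Suc n)"
  by (rule permutes_not_in[OF B_group_permutes[OF B]]; simp add: pm_def)+

lemma signed_perm_Suc: "signed_perm (Suc n) \<sigma>"
  by (simp add: signed_perm_def B_group_Suc[OF B])

end

declare of_nat_Suc [simp del]

text \<open>The two new fixed points form one positive cycle of length 1, which adds 0 to the norm
  and leaves the negative cycles alone.\<close>

lemma (in signed_perm) phi_Suc: "phi qp qm (Suc n) \<sigma> = phi qp qm n \<sigma>"
proof -
  let ?N = "int (Suc n)"
  have orb: "orbit \<sigma> ?N = {?N}" "orbit \<sigma> (- ?N) = {- ?N}"
    by (simp_all only: orbit_eq_singleton_iff fixes_last)
  have cyc: "cycle_sets (Suc n) \<sigma> = insert {?N} (insert {- ?N} (cycle_sets n \<sigma>))"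
    using orb by (auto simp: cycle_sets_def pm_Suc)
  have neg: "neg_cycles (Suc n) \<sigma> = neg_cycles n \<sigma>"
    unfolding neg_cycles_def cyc by auto
  have pos: "pos_cycles (Suc n) \<sigma> = insert {?N, - ?N} (pos_cycles n \<sigma>)"
  proof -
    have "?N \<noteq> - ?N" by simp
    then have "{C \<in> cycle_sets (Suc n) \<sigma>. uminus ` C \<noteq> C} =
        insert {?N} (insert {- ?N} {C \<in> cycle_sets n \<sigma>. uminus ` C \<noteq> C})"
      unfolding cyc by auto
    then show ?thesis unfolding pos_cycles_eq by (simp add: insert_commute[of "- ?N"])
  qed
  have new: "{?N, - ?N} \<notin> pos_cycles n \<sigma>"
    using cycles_subset[of "{?N, - ?N}"] by (auto simp: pm_def)
  have "(\<Sum>C\<in>pos_cycles (Suc n) \<sigma>. card C div 2 - 1) = (\<Sum>C\<in>pos_cycles n \<sigma>. card C div 2 - 1)"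
    unfolding pos by (subst sum.insert[OF finite_pos_cycles new]) (simp add: card_insert_if)
  then show ?thesis
    unfolding signed_perm.phi_eq[OF signed_perm_Suc] phi_eq neg by simp
qed

text \<open>
  For \<open>i = -(n+1)\<close> the two transpositions of the general case coincide and would cancel.
\<close>

definition flip :: "nat \<Rightarrow> int \<Rightarrow> int \<Rightarrow> int" where
  "flip n i = (if i = int (Suc n) then id
     else if i = - int (Suc n) then Transposition.transpose i (int (Suc n))
     else Transposition.transpose i (int (Suc n)) \<circ> Transposition.transpose (- i) (- int (Suc n)))"

lemma flip_apply:
  assumes "i \<in> pm (Suc n)"
  shows "flip n i j = (if j = i then int (Suc n) else if j = - i then - int (Suc n)
     else if j = int (Suc n) then i else if j = - int (Suc n) then - i else j)"
proof -
  have "i \<noteq> - i" using assms by (auto simp: pm_def)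
  then show ?thesis by (auto simp: flip_def Transposition.transpose_def)
qed

lemma flip_flip: "i \<in> pm (Suc n) \<Longrightarrow> flip n i (flip n i j) = j"
  by (auto simp: flip_apply pm_def)

lemma flip_permutes: "i \<in> pm (Suc n) \<Longrightarrow> flip n i permutes pm (Suc n)"
proof (rule bij_imp_permutes)
  assume i: "i \<in> pm (Suc n)"
  show "bij_betw (flip n i) (pm (Suc n)) (pm (Suc n))"
    by (rule bij_betwI[where g="flip n i"]) (use i in \<open>auto simp: flip_flip, auto simp: flip_apply pm_def\<close>)
  show "flip n i j = j" if "j \<notin> pm (Suc n)" for j
    using that i by (auto simp: flip_apply pm_def)
qed

lemma flip_B_group:
  assumes "i \<in> pm (Suc n)"
  shows "flip n i \<in> B_group (Suc n)"
proof (rule B_groupI)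
  show "flip n i permutes pm (Suc n)" using assms by (rule flip_permutes)
  show "flip n i (- j) = - flip n i j" for j
    using assms by (auto simp: flip_apply pm_def)
qed

section \<open>Change of the weight under composition with \<open>flip\<close>\<close>

definition flip_weight :: "real \<Rightarrow> real \<Rightarrow> nat \<Rightarrow> int \<Rightarrow> real" where
  "flip_weight qp qm n i = (if i = int (Suc n) then 1 else if i = - int (Suc n) then qm else qp)"

lemma (in signed_perm) signed_perm_flip:
  "i \<in> pm (Suc n) \<Longrightarrow> signed_perm (Suc n) (\<sigma> \<circ> flip n i)"
  by (simp add: signed_perm_def B_group_comp flip_B_group B_group_Suc[OF B])

text \<open>The new orbit consisting of \<open>n+1\<close> and \<open>-(n+1)\<close> is a negative
  cycle of length 1. It adds 0 to the norm and one factor \<open>qm\<close>.\<close>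

lemma (in signed_perm) phi_flip_neg:
  "phi qp qm (Suc n) (\<sigma> \<circ> flip n (- int (Suc n))) = qm * phi qp qm n \<sigma>"
proof -
  let ?N = "int (Suc n)"
  define \<tau> where "\<tau> = \<sigma> \<circ> flip n (- ?N)"
  have N: "- ?N \<in> pm (Suc n)" by (simp add: pm_def)
  interpret S: signed_perm "Suc n" \<tau> unfolding \<tau>_def by (rule signed_perm_flip[OF N])
  have s: "\<tau> ?N = - ?N" "\<tau> (- ?N) = ?N"
    using fixes_last by (simp_all add: flip_apply[OF N] \<tau>_def)
  have s': "\<tau> j = \<sigma> j" if "j \<in> pm n" for j
    using flip_apply[OF N, of j] pm_neq_last[OF that] by (auto simp: \<tau>_def)
  have "orbit \<tau> a \<subseteq> {?N, - ?N}" if "a \<in> {?N, - ?N}" for a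
  proof
    fix b assume "b \<in> orbit \<tau> a"
    then show "b \<in> {?N, - ?N}" by induct (use s that in auto)
  qed
  moreover have "{?N, - ?N} \<subseteq> orbit \<tau> a" if "a \<in> {?N, - ?N}" for a
    using that s orbit.base[of \<tau> a] S.self_in_orbit[of a] by auto
  ultimately have orb: "orbit \<tau> ?N = {?N, - ?N}" "orbit \<tau> (- ?N) = {?N, - ?N}" by blast+
  \<comment> \<open>Both permutations agree on \<open>pm n\<close>, which contains the whole orbit
    of \<open>a\<close> under \<open>\<sigma>\<close>.\<close>
  have orb': "orbit \<tau> a = orbit \<sigma> a" if "a \<in> pm n" for a
    by (rule orbit_cong[OF self_in_orbit]) (use s' orbit_subset_pm[OF that] in blast)
  have cyc: "cycle_sets (Suc n) \<tau> = insert {?N, - ?N} (cycle_sets n \<sigma>)"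
    using orb orb' by (simp add: cycle_sets_def pm_Suc cong: image_cong)
  have sym: "uminus ` {?N, - ?N} = {?N, - ?N}" by (simp add: insert_commute)
  have neg: "neg_cycles (Suc n) \<tau> = insert {?N, - ?N} (neg_cycles n \<sigma>)"
    unfolding neg_cycles_def cyc using sym by blast
  have pos: "pos_cycles (Suc n) \<tau> = pos_cycles n \<sigma>"
    unfolding pos_cycles_def cyc using sym by blast
  have new: "{?N, - ?N} \<notin> neg_cycles n \<sigma>"
    using cycles_subset[of "{?N, - ?N}"] pm_neq_last(1)[of ?N n] by blast
  have "(\<Sum>C\<in>neg_cycles (Suc n) \<tau>. card C div 2 - 1) = (\<Sum>C\<in>neg_cycles n \<sigma>. card C div 2 - 1)"
    unfolding neg by (subst sum.insert[OF finite_neg_cycles new]) (simp add: card_insert_if)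
  moreover have "card (neg_cycles (Suc n) \<tau>) = Suc (card (neg_cycles n \<sigma>))"
    unfolding neg by (rule card_insert_disjoint[OF finite_neg_cycles new])
  ultimately have "phi qp qm (Suc n) \<tau> = qm * phi qp qm n \<sigma>"
    unfolding S.phi_eq phi_eq pos by simp
  then show ?thesis unfolding \<tau>_def .
qed

text \<open>The support of a cycle after \<open>n+1\<close> has been inserted behind
  \<open>i\<close> and \<open>-(n+1)\<close> behind \<open>- i\<close>. The two insertions are
  independent, so one formula serves single orbits, which may contain only one of \<open>i\<close>
  and \<open>- i\<close>, and also the union of an orbit with its barred orbit.\<close>

definition insert_last :: "nat \<Rightarrow> int \<Rightarrow> int set \<Rightarrow> int set" where
  "insert_last n i C =
     {j. j \<in> C \<or> j = int (Suc n) \<and> i \<in> C \<or> j = - int (Suc n) \<and> - i \<in> C}"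

lemma insert_last_Un: "insert_last n i (C \<union> D) = insert_last n i C \<union> insert_last n i D"
  by (auto simp: insert_last_def)

lemma insert_last_uminus: "insert_last n i (uminus ` C) = uminus ` insert_last n i C"
proof -
  have "x \<in> uminus ` insert_last n i C \<longleftrightarrow> x \<in> insert_last n i (uminus ` C)" for x
  proof -
    have m: "y \<in> uminus ` A \<longleftrightarrow> - y \<in> A" for y and A :: "int set"
      by (metis image_iff minus_minus)
    show ?thesis unfolding m insert_last_def by (auto simp: m)
  qed
  then show ?thesis by blast
qed

text \<open>The inserted elements lie outside \<open>pm n\<close>, so intersecting with
  \<open>pm n\<close> undoes the insertion. This is the source of injectivity.\<close>

lemma insert_last_Int: "C \<subseteq> pm n \<Longrightarrow> insert_last n i C \<inter> pm n = C"
  by (auto simp: insert_last_def pm_def)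

lemma inj_on_insert_last: "inj_on (insert_last n i) (Pow (pm n))"
  by (rule inj_onI) (metis insert_last_Int PowD)

text \<open>A set closed under negation receives both new elements or neither, so half its
  cardinality grows by one exactly when it contains \<open>i\<close>.\<close>

lemma card_insert_last:
  assumes "C \<subseteq> pm n" "uminus ` C = C"
  shows "card (insert_last n i C) = card C + (if i \<in> C then 2 else 0)"
proof (cases "i \<in> C")
  case True
  then have "- i \<in> C" using assms(2) by blast
  with True have "insert_last n i C = insert (int (Suc n)) (insert (- int (Suc n)) C)"
    by (auto simp: insert_last_def)
  moreover have "int (Suc n) \<notin> insert (- int (Suc n)) C" "- int (Suc n) \<notin> C"
    using assms(1) by (auto simp: pm_def)
  moreover have "finite C" using assms(1) finite_pm finite_subset by blast
  ultimately show ?thesis using True by simp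
next
  case False
  then have "- i \<notin> C" using assms(2) by (metis imageI minus_minus)
  with False show ?thesis by (simp add: insert_last_def)
qed

lemma Collect_image:
  "(\<And>x. x \<in> S \<Longrightarrow> P (f x) \<longleftrightarrow> Q x) \<Longrightarrow> {y \<in> f ` S. P y} = f ` {x \<in> S. Q x}"
  by auto

text \<open>The modified permutation runs \<open>i\<close>, \<open>n+1\<close>,
  \<open>\<sigma> i\<close>, and likewise for the barred elements, so \<open>insert_last\<close>
  maps the old cycles to the new ones. Signs and the number of cycles are kept, and exactly one
  recorded cycle gains one unit of length, which gives the factor \<open>qp\<close>.\<close>

lemma (in signed_perm) phi_flip:
  assumes i: "i \<in> pm n"
  shows "phi qp qm (Suc n) (\<sigma> \<circ> flip n i) = qp * phi qp qm n \<sigma>"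
proof -
  let ?N = "int (Suc n)" and ?E = "insert_last n i"
  define \<tau> where "\<tau> = \<sigma> \<circ> flip n i"
  have i': "i \<in> pm (Suc n)" and ne: "i \<noteq> - i" "i \<noteq> ?N" "i \<noteq> - ?N" "- i \<noteq> ?N" "- i \<noteq> - ?N" "?N \<noteq> - ?N"
    using i by (auto simp: pm_def)
  interpret S: signed_perm "Suc n" \<tau> unfolding \<tau>_def by (rule signed_perm_flip[OF i'])
  have s: "\<tau> i = ?N" "\<tau> (- i) = - ?N" "\<tau> ?N = \<sigma> i" "\<tau> (- ?N) = \<sigma> (- i)"
    using fixes_last ne ne[symmetric] by (simp_all add: flip_apply[OF i'] \<tau>_def)
  have s': "\<tau> j = \<sigma> j" if "j \<noteq> i" "j \<noteq> - i" "j \<noteq> ?N" "j \<noteq> - ?N" for j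
    using that by (simp add: flip_apply[OF i'] \<tau>_def)
  have E: "b \<in> ?E C \<longleftrightarrow> b \<in> C \<or> b = ?N \<and> i \<in> C \<or> b = - ?N \<and> - i \<in> C" for b C
    unfolding insert_last_def by blast
  have orb: "orbit \<tau> a = ?E (orbit \<sigma> a)" if a: "a \<in> pm n" for a
  proof
    \<comment> \<open>For the first inclusion it suffices that the enlarged orbit is closed under
      \<open>\<tau>\<close>.\<close>
    have stepE: "\<tau> b \<in> ?E (orbit \<sigma> a)" if b: "b \<in> ?E (orbit \<sigma> a)" for b
    proof -
      consider "b = ?N" "i \<in> orbit \<sigma> a" | "b = - ?N" "- i \<in> orbit \<sigma> a"
        | "b = i" "b \<in> orbit \<sigma> a" | "b = - i" "b \<in> orbit \<sigma> a"
        | "b \<noteq> i" "b \<noteq> - i" "b \<in> orbit \<sigma> a"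
        using b unfolding E by blast
      then show ?thesis
      proof cases
        case 5
        then have "b \<in> pm n" using orbit_subset_pm[OF a] by blast
        then have "\<tau> b = \<sigma> b" using s' 5 pm_neq_last by blast
        then show ?thesis using 5 by (simp add: E orbit.step)
      qed (simp_all add: E s orbit.step)
    qed
    have "a \<in> ?E (orbit \<sigma> a)" unfolding E using self_in_orbit by blast
    then have start: "\<tau> a \<in> ?E (orbit \<sigma> a)" by (rule stepE)
    show "orbit \<tau> a \<subseteq> ?E (orbit \<sigma> a)"
    proof
      fix b assume "b \<in> orbit \<tau> a"
      then show "b \<in> ?E (orbit \<sigma> a)" by induct (use start stepE in blast)+
    qed
    \<comment> \<open>For the converse, one step of \<open>\<sigma>\<close> is one step of
      \<open>\<tau>\<close>, or two steps through \<open>n+1\<close> or \<open>-(n+1)\<close> when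
      it starts at \<open>i\<close> or \<open>- i\<close>.\<close>
    have step': "\<sigma> b \<in> orbit \<tau> a" if b: "b \<in> orbit \<tau> a" "b \<in> pm n" for b
    proof -
      consider "b = i" | "b = - i" | "\<tau> b = \<sigma> b" using s' pm_neq_last[OF b(2)] by blast
      then show ?thesis
      proof cases
        case 1 then show ?thesis using s orbit.step[OF orbit.step[OF b(1)]] by simp
      next
        case 2 then show ?thesis using s orbit.step[OF orbit.step[OF b(1)]] by simp
      next
        case 3 then show ?thesis using orbit.step[OF b(1)] by simp
      qed
    qed
    have sub: "orbit \<sigma> a \<subseteq> orbit \<tau> a"
    proof
      fix b assume "b \<in> orbit \<sigma> a"
      then show "b \<in> orbit \<tau> a"
        by induct (use step' S.self_in_orbit a orbit_subset_pm[OF a] in blast)+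
    qed
    have "?N \<in> orbit \<tau> a" if "i \<in> orbit \<tau> a" using orbit.step[OF that] s by simp
    moreover have "- ?N \<in> orbit \<tau> a" if "- i \<in> orbit \<tau> a" using orbit.step[OF that] s by simp
    ultimately show "?E (orbit \<sigma> a) \<subseteq> orbit \<tau> a" using sub E by blast
  qed
  \<comment> \<open>The elements \<open>n+1\<close> and \<open>-(n+1)\<close> lie on the cycles of
    \<open>i\<close> and \<open>- i\<close>, so they start no new cycle.\<close>
  have "orbit \<tau> ?N = orbit \<tau> i" "orbit \<tau> (- ?N) = orbit \<tau> (- i)"
    using S.orbit_eq orbit.base[of \<tau>] s by metis+
  then have cyc: "cycle_sets (Suc n) \<tau> = ?E ` cycle_sets n \<sigma>"
    using i orb by (auto simp: cycle_sets_def pm_Suc image_image)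
  \<comment> \<open>Insertion commutes with negation and is injective on subsets of
    \<open>pm n\<close>; hence the sign of a cycle does not change.\<close>
  have neg_iff: "uminus ` ?E C = ?E C \<longleftrightarrow> uminus ` C = C" if "C \<in> cycle_sets n \<sigma>" for C
  proof -
    have "C \<subseteq> pm n" "uminus ` C \<subseteq> pm n" using cycle_subset_pm[OF that] by auto
    then show ?thesis
      unfolding insert_last_uminus[symmetric] using inj_on_insert_last[of n i]
      by (metis insert_last_Int)
  qed
  have neg: "neg_cycles (Suc n) \<tau> = ?E ` neg_cycles n \<sigma>"
    unfolding neg_cycles_def cyc by (rule Collect_image) (rule neg_iff)
  have pos: "pos_cycles (Suc n) \<tau> = ?E ` pos_cycles n \<sigma>"
  proof -
    have "{C \<in> cycle_sets (Suc n) \<tau>. uminus ` C \<noteq> C} = ?E ` {C \<in> cycle_sets n \<sigma>. uminus ` C \<noteq> C}"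
      unfolding cyc by (rule Collect_image) (use neg_iff in blast)
    then show ?thesis
      unfolding pos_cycles_eq by (simp add: image_image insert_last_uminus[symmetric] insert_last_Un)
  qed
  have inj: "inj_on ?E (pos_cycles n \<sigma>)" "inj_on ?E (neg_cycles n \<sigma>)"
    by (rule inj_on_subset[OF inj_on_insert_last]; use cycles_subset in blast)+
  have len: "card (?E C) div 2 - 1 = (card C div 2 - 1) + (if i \<in> C then 1 else 0)"
    if "C \<in> pos_cycles n \<sigma> \<union> neg_cycles n \<sigma>" for C
    using card_insert_last[OF cycles_subset[OF that] cycles_uminus[OF that], of i]
      cycles_length[OF that] by auto
  have sum: "(\<Sum>C\<in>?E ` A. card C div 2 - 1) = (\<Sum>C\<in>A. card C div 2 - 1) + card {C \<in> A. i \<in> C}"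
    if "A = pos_cycles n \<sigma> \<or> A = neg_cycles n \<sigma>" for A
  proof -
    have "finite A" using that finite_pos_cycles finite_neg_cycles by blast
    have "(\<Sum>C\<in>?E ` A. card C div 2 - 1) = (\<Sum>C\<in>A. card (?E C) div 2 - 1)"
      using that inj by (subst sum.reindex) auto
    also have "\<dots> = (\<Sum>C\<in>A. (card C div 2 - 1) + (if i \<in> C then 1 else 0))"
      using that len by (intro sum.cong) auto
    also have "\<dots> = (\<Sum>C\<in>A. card C div 2 - 1) + card {C \<in> A. i \<in> C}"
      using \<open>finite A\<close> by (simp add: sum.distrib sum.If_cases Int_def)
    finally show ?thesis .
  qed
  \<comment> \<open>Exactly one recorded cycle passes through \<open>i\<close>, so the exponent of
    \<open>qp\<close> rises by exactly one.\<close>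
  have "card {C \<in> pos_cycles n \<sigma>. i \<in> C} + card {C \<in> neg_cycles n \<sigma>. i \<in> C} = 1"
    unfolding pos_cycles_containing[OF i] neg_cycles_containing[OF i] by simp
  then have "(\<Sum>C\<in>pos_cycles (Suc n) \<tau>. card C div 2 - 1) + (\<Sum>C\<in>neg_cycles (Suc n) \<tau>. card C div 2 - 1)
    = Suc ((\<Sum>C\<in>pos_cycles n \<sigma>. card C div 2 - 1) + (\<Sum>C\<in>neg_cycles n \<sigma>. card C div 2 - 1))"
    unfolding pos neg using sum[of "pos_cycles n \<sigma>"] sum[of "neg_cycles n \<sigma>"] by simp
  moreover have "card (neg_cycles (Suc n) \<tau>) = card (neg_cycles n \<sigma>)"
    unfolding neg by (rule card_image[OF inj(2)])
  ultimately have "phi qp qm (Suc n) \<tau> = qp * phi qp qm n \<sigma>"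
    unfolding S.phi_eq phi_eq by (simp only: power_Suc mult.assoc)
  then show ?thesis unfolding \<tau>_def .
qed

lemma phi_comp_flip:
  assumes "\<sigma> \<in> B_group n" "i \<in> pm (Suc n)"
  shows "phi qp qm (Suc n) (\<sigma> \<circ> flip n i) = flip_weight qp qm n i * phi qp qm n \<sigma>"
proof -
  interpret signed_perm n \<sigma> by unfold_locales (rule assms)
  consider "i = int (Suc n)" | "i = - int (Suc n)" | "i \<in> pm n" "i \<noteq> int (Suc n)" "i \<noteq> - int (Suc n)"
    using assms(2) unfolding pm_Suc by (metis insertE)
  then show ?thesis
  proof cases
    case 1
    have "flip n (int (Suc n)) = id" by (simp add: flip_def)
    with 1 show ?thesis by (simp only: comp_id phi_Suc flip_weight_def) simp
  next
    case 2
    moreover have "- int (Suc n) \<noteq> int (Suc n)" by simp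
    ultimately show ?thesis by (simp only: phi_flip_neg flip_weight_def) simp
  next
    case 3
    then show ?thesis by (simp only: phi_flip flip_weight_def) simp
  qed
qed

section \<open>Factorisation of \<open>B(n+1)\<close> over \<open>B(n)\<close>\<close>

lemma bij_betw_flip:
  "bij_betw (\<lambda>(\<sigma>, i). \<sigma> \<circ> flip n i) (B_group n \<times> pm (Suc n)) (B_group (Suc n))"
\<comment> \<open>The index is recovered as the preimage of \<open>n+1\<close>:
  \<open>flip n i\<close> sends \<open>i\<close> to \<open>n+1\<close>, which every element of
  \<open>B(n)\<close> fixes. Composing with the same involution again recovers the first
  factor.\<close>
proof (rule bij_betwI[where g="\<lambda>\<tau>. (\<tau> \<circ> flip n (inv \<tau> (int (Suc n))), inv \<tau> (int (Suc n)))"])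
  let ?N = "int (Suc n)"
  have N: "?N \<in> pm (Suc n)" by (simp add: pm_def)
  show "(\<lambda>(\<sigma>, i). \<sigma> \<circ> flip n i) \<in> B_group n \<times> pm (Suc n) \<rightarrow> B_group (Suc n)"
    using B_group_comp[OF B_group_Suc flip_B_group] by auto
  have inv_pm: "inv \<tau> ?N \<in> pm (Suc n)" if "\<tau> \<in> B_group (Suc n)" for \<tau>
    using permutes_in_image[OF permutes_inv[OF B_group_permutes[OF that]]] N by blast
  show "(\<lambda>\<tau>. (\<tau> \<circ> flip n (inv \<tau> ?N), inv \<tau> ?N)) \<in> B_group (Suc n) \<rightarrow> B_group n \<times> pm (Suc n)"
  proof
    fix \<tau> assume t: "\<tau> \<in> B_group (Suc n)"
    have i: "inv \<tau> ?N \<in> pm (Suc n)" by (rule inv_pm[OF t])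
    have "flip n (inv \<tau> ?N) ?N = inv \<tau> ?N" using i by (auto simp: flip_apply pm_def)
    then have "(\<tau> \<circ> flip n (inv \<tau> ?N)) ?N = ?N"
      by (simp add: permutes_inverses(1)[OF B_group_permutes[OF t]])
    then show "(\<tau> \<circ> flip n (inv \<tau> ?N), inv \<tau> ?N) \<in> B_group n \<times> pm (Suc n)"
      using i B_group_comp[OF t flip_B_group[OF i]] B_group_fix by blast
  qed
  have ff: "\<sigma> \<circ> flip n i \<circ> flip n i = \<sigma>" if "i \<in> pm (Suc n)" for \<sigma> i
    using flip_flip[OF that] by (auto simp: fun_eq_iff)
  show "(case (case p of (\<sigma>, i) \<Rightarrow> \<sigma> \<circ> flip n i) of \<tau> \<Rightarrow> (\<tau> \<circ> flip n (inv \<tau> ?N), inv \<tau> ?N)) = p"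
    if p: "p \<in> B_group n \<times> pm (Suc n)" for p
  proof -
    obtain \<sigma> i where [simp]: "p = (\<sigma>, i)" and s: "\<sigma> \<in> B_group n" and i: "i \<in> pm (Suc n)"
      using p by auto
    let ?\<tau> = "\<sigma> \<circ> flip n i"
    have t: "?\<tau> permutes pm (Suc n)"
      using B_group_permutes[OF B_group_comp[OF B_group_Suc[OF s] flip_B_group[OF i]]] .
    have "flip n i i = ?N" using i by (simp add: flip_apply)
    then have "?\<tau> i = ?N"
      using signed_perm.fixes_last(1)[of n \<sigma>] s by (simp add: signed_perm_def)
    then have "inv ?\<tau> ?N = i" using permutes_inv_eq[OF t] by blast
    then show ?thesis using ff[OF i] by simp
  qed
  show "(case (\<tau> \<circ> flip n (inv \<tau> ?N), inv \<tau> ?N) of (\<sigma>, i) \<Rightarrow> \<sigma> \<circ> flip n i) = \<tau>"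
    if "\<tau> \<in> B_group (Suc n)" for \<tau>
    using ff[OF inv_pm[OF that]] by simp
qed


section \<open>Tensor powers and the free inner product\<close>

interpretation K: vector_space kscale
  by (rule vector_space_kscale)

lemma sum_functional_apply: "(\<Sum>i\<in>S. h i) w = (\<Sum>i\<in>S. h i w)" for h :: "'i \<Rightarrow> 'a functional"
  by (induction S rule: infinite_finite_induct) auto

lemma kscale_apply: "kscale c F w = c * F w"
  by (simp add: kscale_def)

text \<open>
  Induction rules leave eta-expanded sums of functionals behind, which these rules would unfold pointwise.
\<close>

declare zero_fun_apply [simp del] plus_fun_apply [simp del]

lemma linear_kscaleD:
  assumes "Vector_Spaces.linear kscale kscale T"
  shows "T (F + G) = T F + T G" "T (kscale c F) = kscale c (T F)" "T 0 = 0"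
    "T (F - G) = T F - T G" "T (\<Sum>i\<in>S. h i) = (\<Sum>i\<in>S. T (h i))"
proof -
  interpret Vector_Spaces.linear kscale kscale T by (rule assms)
  show "T (F + G) = T F + T G" "T (kscale c F) = kscale c (T F)" "T 0 = 0"
    "T (F - G) = T F - T G" "T (\<Sum>i\<in>S. h i) = (\<Sum>i\<in>S. T (h i))"
    by (rule add scale zero diff sum)+
qed

lemma tens_in_tensor_power [simp]: "tens n x \<in> tensor_power n"
  by (simp add: tensor_power_def K.span_base)

lemma tensor_power_zero [simp]: "0 \<in> tensor_power n"
  by (simp add: tensor_power_def K.span_zero)

lemma tensor_power_add [simp]: "F \<in> tensor_power n \<Longrightarrow> G \<in> tensor_power n \<Longrightarrow> F + G \<in> tensor_power n"
  by (simp add: tensor_power_def K.span_add)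

lemma tensor_power_diff [simp]: "F \<in> tensor_power n \<Longrightarrow> G \<in> tensor_power n \<Longrightarrow> F - G \<in> tensor_power n"
  by (simp add: tensor_power_def K.span_diff)

lemma tensor_power_scale [simp]: "F \<in> tensor_power n \<Longrightarrow> kscale c F \<in> tensor_power n"
  by (simp add: tensor_power_def K.span_scale)

lemma tensor_power_sum [simp]:
  "(\<And>i. i \<in> S \<Longrightarrow> h i \<in> tensor_power n) \<Longrightarrow> (\<Sum>i\<in>S. h i) \<in> tensor_power n"
  by (simp add: tensor_power_def K.span_sum)

lemma tensor_power_induct [consumes 1, case_names zero step]:
  assumes "F \<in> tensor_power n" "P 0"
    and "\<And>c x G. G \<in> tensor_power n \<Longrightarrow> P G \<Longrightarrow> P (kscale c (tens n x) + G)"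
  shows "P F"
proof -
  have "F \<in> tensor_power n \<and> P F"
    using assms(1) unfolding tensor_power_def
  proof (induction rule: K.span_induct_alt)
    case base then show ?case using assms(2) by (simp add: K.span_zero)
  next
    case (step c t G)
    then show ?case
      using assms(3) by (auto simp: tensor_power_def[symmetric])
  qed
  then show ?thesis ..
qed

lemma linear_eq_on_tensor_power:
  assumes "Vector_Spaces.linear kscale kscale T" "Vector_Spaces.linear kscale kscale U"
    and "\<And>x. T (tens n x) = U (tens n x)" "F \<in> tensor_power n"
  shows "T F = U F"
  using assms(4)
  by (induction rule: tensor_power_induct)
    (simp_all add: linear_kscaleD[OF assms(1)] linear_kscaleD[OF assms(2)] assms(3))

lemma linear_in_tensor_power:
  assumes "Vector_Spaces.linear kscale kscale T" "\<And>x. T (tens n x) \<in> tensor_power m"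
    and "F \<in> tensor_power n"
  shows "T F \<in> tensor_power m"
  using assms(3)
  by (induction rule: tensor_power_induct) (simp_all add: linear_kscaleD[OF assms(1)] assms(2))

lemma tensor_power_expansion:
  assumes "F \<in> tensor_power n"
  obtains S a where "finite S" "F = (\<Sum>x\<in>S. kscale (a x) (tens n x))"
proof -
  have "\<exists>S a. finite S \<and> F = (\<Sum>x\<in>S. kscale (a x) (tens n x))"
    using assms
  proof (induction rule: tensor_power_induct)
    case zero
    have "finite {} \<and> 0 = (\<Sum>x\<in>{}. kscale (undefined x) (tens n x))" by simp
    then show ?case by blast
  next
    case (step c x G)
    then obtain S a where S: "finite S" "G = (\<Sum>x\<in>S. kscale (a x) (tens n x))" by blast
    \<comment> \<open>The new tensor may already occur in \<open>S\<close>, and then the two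
      coefficients are added. Outside \<open>S\<close> the values of \<open>a\<close> are arbitrary
      and are replaced by 0.\<close>
    let ?b = "\<lambda>y. (if y = x then c else 0) + (if y \<in> S then a y else 0)"
    have "(\<Sum>y\<in>insert x S. kscale (?b y) (tens n y)) =
        (\<Sum>y\<in>insert x S. if y = x then kscale c (tens n y) else 0)
        + (\<Sum>y\<in>insert x S. if y \<in> S then kscale (a y) (tens n y) else 0)"
      unfolding sum.distrib[symmetric]
      by (rule sum.cong) (auto simp: K.scale_left_distrib)
    also have "(\<Sum>y\<in>insert x S. if y = x then kscale c (tens n y) else 0) = kscale c (tens n x)"
      using S(1) by simp
    also have "(\<Sum>y\<in>insert x S. if y \<in> S then kscale (a y) (tens n y) else 0) = G"
      unfolding S(2) sum.inter_restrict[OF finite.insertI[OF S(1)], symmetric]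
      by (simp add: Int_absorb1 subset_insertI)
    finally have "finite (insert x S) \<and> kscale c (tens n x) + G =
        (\<Sum>y\<in>insert x S. kscale (?b y) (tens n y))"
      using S(1) by (simp only: finite_insert)
    then show ?case by (rule exI[of _ "insert x S", OF exI[of _ ?b]])
  qed
  then show thesis using that by blast
qed

text \<open>A reproducing kernel property: the value of \<open>G\<close> at \<open>x\<close> is the
  product of \<open>tens n x\<close> with \<open>G\<close>. The form thus needs an expansion of the
  first argument only, and linearity in the second becomes pointwise.\<close>

lemma free_inner_expansion:
  assumes "finite S" "F = (\<Sum>x\<in>S. kscale (a x) (tens n x))" "G \<in> tensor_power n"
  shows "free_inner n F G = (\<Sum>x\<in>S. cnj (a x) * G x)"
proof -
  obtain T b where T: "finite T" "G = (\<Sum>y\<in>T. kscale (b y) (tens n y))"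
    using tensor_power_expansion[OF assms(3)] by blast
  show ?thesis
    unfolding assms(2) T(2) free_inner_sum_tens[OF assms(1) T(1)]
    by (simp add: sum_functional_apply kscale_apply tens_def sum_distrib_left mult.assoc)
qed

lemma free_inner_commute:
  assumes "F \<in> tensor_power n" "G \<in> tensor_power n"
  shows "free_inner n G F = cnj (free_inner n F G)"
proof -
  obtain S a where S: "finite S" "F = (\<Sum>x\<in>S. kscale (a x) (tens n x))"
    using tensor_power_expansion[OF assms(1)] by blast
  obtain T b where T: "finite T" "G = (\<Sum>y\<in>T. kscale (b y) (tens n y))"
    using tensor_power_expansion[OF assms(2)] by blast
  show ?thesis
    unfolding S(2) T(2) free_inner_sum_tens[OF S(1) T(1)] free_inner_sum_tens[OF T(1) S(1)]
    by (subst sum.swap) (simp add: cinner_commute[symmetric] mult_ac)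
qed

lemma free_inner_right:
  assumes "F \<in> tensor_power n" "G \<in> tensor_power n" "G' \<in> tensor_power n"
  shows "free_inner n F (G + G') = free_inner n F G + free_inner n F G'"
    "free_inner n F (kscale c G) = c * free_inner n F G"
    "free_inner n F 0 = 0"
proof -
  obtain S a where S: "finite S" "F = (\<Sum>x\<in>S. kscale (a x) (tens n x))"
    using tensor_power_expansion[OF assms(1)] by blast
  note E = free_inner_expansion[OF S]
  show "free_inner n F (G + G') = free_inner n F G + free_inner n F G'"
    using assms by (simp add: E sum.distrib distrib_left plus_fun_apply)
  show "free_inner n F (kscale c G) = c * free_inner n F G"
    using assms by (simp add: E kscale_apply sum_distrib_left mult_ac)
  show "free_inner n F 0 = 0" by (simp add: E zero_fun_apply)
qed

lemma free_inner_left: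
  assumes "F \<in> tensor_power n" "G \<in> tensor_power n" "F' \<in> tensor_power n"
  shows "free_inner n (F + F') G = free_inner n F G + free_inner n F' G"
    "free_inner n (kscale c F) G = cnj c * free_inner n F G"
    "free_inner n 0 G = 0"
  using assms free_inner_right[OF assms(2) assms(1) assms(3)]
  by (simp_all add: free_inner_commute[of G n])

lemma free_inner_diff_left:
  assumes "F \<in> tensor_power n" "G \<in> tensor_power n" "F' \<in> tensor_power n"
  shows "free_inner n (F - F') G = free_inner n F G - free_inner n F' G"
  using free_inner_left(1)[of "F - F'" n G F'] assms by simp

lemma free_inner_sum_right:
  assumes "F \<in> tensor_power n" "\<And>i. i \<in> S \<Longrightarrow> h i \<in> tensor_power n"
  shows "free_inner n F (\<Sum>i\<in>S. h i) = (\<Sum>i\<in>S. free_inner n F (h i))"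
  using assms(2)
proof (induction S rule: infinite_finite_induct)
  case (insert i S)
  then show ?case using assms(1) by (simp add: free_inner_right(1))
qed (use assms(1) in \<open>simp_all add: free_inner_right(3)[where G = 0 and G' = 0]\<close>)

lemma free_inner_sum_left:
  assumes "G \<in> tensor_power n" "\<And>i. i \<in> S \<Longrightarrow> h i \<in> tensor_power n"
  shows "free_inner n (\<Sum>i\<in>S. h i) G = (\<Sum>i\<in>S. free_inner n (h i) G)"
  using assms(2)
proof (induction S rule: infinite_finite_induct)
  case (insert i S)
  then show ?case using assms(1) by (simp add: free_inner_left(1))
qed (use assms(1) in \<open>simp_all add: free_inner_left(3)[where F = 0 and F' = 0]\<close>)

lemma tens_cong: "(\<And>i. i \<in> pm n \<Longrightarrow> x i = y i) \<Longrightarrow> tens n x = tens n y"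
  by (simp add: tens_def fun_eq_iff)

section \<open>The operator \<open>P_op\<close> on tensor powers\<close>

lemma linear_kscale_sum:
  assumes "\<And>i. i \<in> S \<Longrightarrow> Vector_Spaces.linear kscale kscale (h i)"
  shows "Vector_Spaces.linear kscale kscale (\<lambda>F. \<Sum>i\<in>S. kscale (c i) (h i F))"
proof (rule linear_kscaleI)
  show "(\<Sum>i\<in>S. kscale (c i) (h i (F + G))) =
      (\<Sum>i\<in>S. kscale (c i) (h i F)) + (\<Sum>i\<in>S. kscale (c i) (h i G))" for F G
    unfolding sum.distrib[symmetric]
    by (rule sum.cong) (simp_all add: linear_kscaleD(1)[OF assms] K.scale_right_distrib)
  show "(\<Sum>i\<in>S. kscale (c i) (h i (kscale d F))) = kscale d (\<Sum>i\<in>S. kscale (c i) (h i F))" for d F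
    unfolding K.scale_sum_right
    by (rule sum.cong) (simp_all add: linear_kscaleD(2)[OF assms] mult.commute)
qed

lemma linear_P_op: "Vector_Spaces.linear kscale kscale (P_op qp qm n :: 'a::real_inner functional \<Rightarrow> _)"
proof (cases "n = 0")
  case True
  then show ?thesis by (auto intro!: linear_kscaleI simp: P_op_def)
next
  case False
  then show ?thesis
    using linear_kscale_sum[OF act_tens(1)] by (simp add: P_op_def[abs_def])
qed

text \<open>In degree 0 the identity fits the same formula, since \<open>B(0)\<close> contains only
  \<open>id\<close>, with weight 1.\<close>

lemma P_op_tens:
  "P_op qp qm n (tens n x) =
     (\<Sum>\<sigma>\<in>B_group n. kscale (complex_of_real (phi qp qm n \<sigma>)) (tens n (x \<circ> \<sigma>)))"
  by (cases "n = 0") (simp_all add: P_op_def act_tens B_group_0 phi_0 del: sum_constant)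

lemma P_op_in_tensor_power: "F \<in> tensor_power n \<Longrightarrow> P_op qp qm n F \<in> tensor_power n"
  by (rule linear_in_tensor_power[OF linear_P_op]) (simp_all add: P_op_tens)

section \<open>Creation and its adjoint\<close>

definition creation_comp ::
  "nat \<Rightarrow> 'a::real_inner cplx \<Rightarrow> 'a cplx \<Rightarrow> 'a functional \<Rightarrow> 'a functional" where
  "creation_comp n x y = lin_ext n (\<lambda>z. tens (Suc n) (z(- int (Suc n) := x, int (Suc n) := y)))"

lemma creation_Suc: "creation x y f (Suc n) = creation_comp n x y (f n)"
  and creation_0: "creation x y f 0 = 0"
  by (simp_all add: creation_def creation_comp_def)

lemmas linear_creation_comp = creation_ext(1)[folded creation_comp_def]
  and creation_comp_tens = creation_ext(2)[folded creation_comp_def]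

lemma creation_comp_in_tensor_power:
  "F \<in> tensor_power n \<Longrightarrow> creation_comp n x y F \<in> tensor_power (Suc n)"
  by (rule linear_in_tensor_power[OF linear_creation_comp]) (simp_all add: creation_comp_tens)

text \<open>The free annihilation operator. Functionals are evaluated with \<open>x\<close> and
  \<open>y\<close> in the two outer slots, which pairs the outer entries of a simple tensor with
  \<open>x\<close> and \<open>y\<close>.\<close>

definition contract ::
  "nat \<Rightarrow> 'a::real_inner cplx \<Rightarrow> 'a cplx \<Rightarrow> 'a functional \<Rightarrow> 'a functional" where
  "contract n x y F = (\<lambda>w. F (w(- int (Suc n) := x, int (Suc n) := y)))"

lemma linear_contract: "Vector_Spaces.linear kscale kscale (contract n x y)"
  by (rule linear_kscaleI) (auto simp: contract_def kscale_def plus_fun_apply)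

lemma contract_tens:
  "contract n x y (tens (Suc n) z) =
     kscale (cinner x (z (- int (Suc n))) * cinner y (z (int (Suc n)))) (tens n z)"
proof (rule ext)
  fix w
  have N: "int (Suc n) \<in> pm (Suc n)" "- int (Suc n) \<noteq> int (Suc n)" by (simp_all add: pm_def)
  have D: "pm (Suc n) - {int (Suc n), - int (Suc n)} = pm n"
    using pm_neq_last unfolding pm_Suc by blast
  have "tens n z (w(- int (Suc n) := x, int (Suc n) := y)) = tens n z w"
    unfolding tens_def by (rule prod.cong) (auto dest: pm_neq_last)
  then show "contract n x y (tens (Suc n) z) w =
      kscale (cinner x (z (- int (Suc n))) * cinner y (z (int (Suc n)))) (tens n z) w"
    unfolding contract_def using N(2)
    by (subst tens_remove2[OF N(1)], subst D) (simp add: kscale_apply tens_def)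
qed

text \<open>The arguments are exchanged in the second contraction because it stems from the index
  \<open>-(n+1)\<close>, whose flip exchanges the two outer positions.\<close>

definition annihilation_comp ::
  "real \<Rightarrow> real \<Rightarrow> nat \<Rightarrow> 'a::real_inner cplx \<Rightarrow> 'a cplx \<Rightarrow> 'a functional \<Rightarrow> 'a functional" where
  "annihilation_comp qp qm n x y F = contract n x y F + kscale (complex_of_real qm) (contract n y x F)
     + kscale (complex_of_real qp) (\<Sum>i\<in>pm n. beta_J n x y i F)"

lemma linear_beta_sum:
  "Vector_Spaces.linear kscale kscale (\<lambda>F. kscale c (\<Sum>i\<in>pm n. beta_J n x y i F))"
  unfolding K.scale_sum_right by (rule linear_kscale_sum) (rule beta_J_tens)

lemma linear_annihilation_comp:
  "Vector_Spaces.linear kscale kscale (annihilation_comp qp qm n x y)"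
  by (rule linear_kscaleI)
    (simp_all add: annihilation_comp_def linear_kscaleD[OF linear_contract]
      linear_kscaleD[OF linear_beta_sum] algebra_simps K.scale_right_distrib)

lemma last_notin_pm: "int (Suc n) \<notin> pm n"
  using pm_neq_last(1) by blast

text \<open>The three summands are the terms \<open>i = n+1\<close>, \<open>i = -(n+1)\<close> and
  \<open>i \<in> pm n\<close> of a single sum over the index set of the factorisation of
  \<open>B(n+1)\<close>.\<close>

lemma annihilation_comp_tens:
  "annihilation_comp qp qm n x y (tens (Suc n) u) =
     (\<Sum>i\<in>pm (Suc n). kscale (complex_of_real (flip_weight qp qm n i) *
        (cinner x (u (flip n i (- int (Suc n)))) * cinner y (u (flip n i (int (Suc n))))))
        (tens n (u \<circ> flip n i)))"
    (is "_ = (\<Sum>i\<in>_. ?g i)")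
proof -
  let ?N = "int (Suc n)"
  have new: "?N \<notin> pm n" "- ?N \<notin> insert ?N (pm n)" "?N \<noteq> - ?N" "- ?N \<noteq> ?N"
    by (simp_all add: last_notin_pm)
  have mem: "?N \<in> pm (Suc n)" "- ?N \<in> pm (Suc n)" by (auto simp: pm_Suc)
  have inner: "?g i = kscale (complex_of_real qp) (beta_J n x y i (tens (Suc n) u))" if i: "i \<in> pm n" for i
  proof -
    note ne = pm_neq_last[OF i]
    have "i \<in> pm (Suc n)" using i by (simp add: pm_Suc)
    then have "flip n i ?N = i" "flip n i (- ?N) = - i"
      using ne new by (auto simp: flip_apply)
    then show ?thesis
      using ne by (simp add: beta_J_tens(2)[OF i] flip_weight_def) (simp add: flip_def)
  qed
  have pos: "?g ?N = contract n x y (tens (Suc n) u)"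
    by (simp add: contract_tens flip_def flip_weight_def)
  \<comment> \<open>This flip moves only the two outer positions, which \<open>tens n\<close> does
    not see.\<close>
  have "tens n (u \<circ> flip n (- ?N)) = tens n u"
    by (rule tens_cong) (use pm_neq_last[where n = n] in \<open>auto simp: flip_apply[OF mem(2)]\<close>)
  moreover have "flip n (- ?N) ?N = - ?N" "flip n (- ?N) (- ?N) = ?N"
    using new by (simp_all add: flip_apply[OF mem(2)])
  ultimately have neg: "?g (- ?N) = kscale (complex_of_real qm) (contract n y x (tens (Suc n) u))"
    using new by (simp add: contract_tens flip_weight_def mult_ac)
  have "(\<Sum>i\<in>pm (Suc n). ?g i) = ?g (- ?N) + (?g ?N + (\<Sum>i\<in>pm n. ?g i))"
    unfolding pm_Suc using new by (subst sum.insert; simp)+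
  also have "(\<Sum>i\<in>pm n. ?g i) = (\<Sum>i\<in>pm n. kscale (complex_of_real qp) (beta_J n x y i (tens (Suc n) u)))"
    using inner by (rule sum.cong[OF refl])
  finally show ?thesis
    unfolding annihilation_comp_def pos neg K.scale_sum_right by (simp only: add_ac)
qed

lemma annihilation_comp_in_tensor_power:
  "F \<in> tensor_power (Suc n) \<Longrightarrow> annihilation_comp qp qm n x y F \<in> tensor_power n"
  by (rule linear_in_tensor_power[OF linear_annihilation_comp]) (simp_all add: annihilation_comp_tens)

text \<open>On the right, each element of \<open>B(n+1)\<close> is written as
  \<open>\<sigma> \<circ> flip n i\<close>. Its weight splits into \<open>flip_weight\<close> and
  the weight of \<open>\<sigma>\<close>. The two outer factors of the product become the coefficient
  of the \<open>i\<close>-th term of the explicit adjoint, and the inner ones give the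
  \<open>\<sigma>\<close>-term of \<open>P_op\<close> in degree \<open>n\<close>.\<close>

lemma adjoint_tens:
  "free_inner n (annihilation_comp qp qm n x y (tens (Suc n) u)) (P_op qp qm n (tens n z)) =
   free_inner (Suc n) (tens (Suc n) u) (P_op qp qm (Suc n) (creation_comp n x y (tens n z)))"
proof -
  let ?N = "int (Suc n)"
  let ?z = "z(- ?N := x, ?N := y)"
  let ?c = "\<lambda>i. cinner (u (flip n i (- ?N))) x * cinner (u (flip n i ?N)) y"
  let ?p = "\<lambda>i \<sigma>. \<Prod>j\<in>pm n. cinner (u (flip n i j)) (z (\<sigma> j))"
  have new: "?N \<notin> pm n" "- ?N \<notin> insert ?N (pm n)" "?N \<noteq> - ?N" "- ?N \<noteq> ?N"
    by (simp_all add: last_notin_pm)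
  have prod: "(\<Prod>k\<in>pm (Suc n). cinner (u k) (?z ((\<sigma> \<circ> flip n i) k))) = ?c i * ?p i \<sigma>"
    if s: "\<sigma> \<in> B_group n" and i: "i \<in> pm (Suc n)" for \<sigma> i
  proof -
    interpret signed_perm n \<sigma> by unfold_locales (rule s)
    \<comment> \<open>Reindexing by the involution moves it from \<open>?z\<close> to
      \<open>u\<close>. As \<open>\<sigma>\<close> fixes the outer positions, \<open>x\<close> and
      \<open>y\<close> are met exactly there.\<close>
    have "(\<Prod>k\<in>pm (Suc n). cinner (u k) (?z ((\<sigma> \<circ> flip n i) k))) =
        (\<Prod>j\<in>pm (Suc n). cinner (u (flip n i j)) (?z (\<sigma> j)))"
      by (subst prod.permute[OF flip_permutes[OF i]]) (simp add: flip_flip[OF i] o_def)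
    also have "\<dots> = cinner (u (flip n i (- ?N))) (?z (\<sigma> (- ?N))) *
        (cinner (u (flip n i ?N)) (?z (\<sigma> ?N)) * (\<Prod>j\<in>pm n. cinner (u (flip n i j)) (?z (\<sigma> j))))"
      unfolding pm_Suc using new by (subst prod.insert; simp)+
    also have "(\<Prod>j\<in>pm n. cinner (u (flip n i j)) (?z (\<sigma> j))) = ?p i \<sigma>"
    proof (rule prod.cong)
      fix j assume "j \<in> pm n"
      then have "\<sigma> j \<in> pm n" using permutes_in_image[OF B_group_permutes[OF s]] by blast
      then show "cinner (u (flip n i j)) (?z (\<sigma> j)) = cinner (u (flip n i j)) (z (\<sigma> j))"
        using pm_neq_last by simp
    qed simp
    finally show ?thesis using new by (simp only: fixes_last fun_upd_apply refl if_True if_False mult_ac)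
  qed
  have "free_inner (Suc n) (tens (Suc n) u) (P_op qp qm (Suc n) (creation_comp n x y (tens n z))) =
      (\<Sum>\<tau>\<in>B_group (Suc n). complex_of_real (phi qp qm (Suc n) \<tau>) *
         (\<Prod>k\<in>pm (Suc n). cinner (u k) (?z (\<tau> k))))"
    by (simp add: creation_comp_tens P_op_tens free_inner_sum_right free_inner_right(2)[where G' = 0]
        free_inner_tens)
  also have "\<dots> = (\<Sum>p\<in>B_group n \<times> pm (Suc n). complex_of_real (phi qp qm (Suc n) (fst p \<circ> flip n (snd p))) *
         (\<Prod>k\<in>pm (Suc n). cinner (u k) (?z ((fst p \<circ> flip n (snd p)) k))))"
    by (subst sum.reindex_bij_betw[OF bij_betw_flip, symmetric]) (simp only: case_prod_unfold)
  also have "\<dots> = (\<Sum>p\<in>B_group n \<times> pm (Suc n). complex_of_real (flip_weight qp qm n (snd p) * phi qp qm n (fst p)) *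
         (?c (snd p) * ?p (snd p) (fst p)))"
  proof (rule sum.cong)
    fix p assume "p \<in> B_group n \<times> pm (Suc n)"
    then have p: "fst p \<in> B_group n" "snd p \<in> pm (Suc n)" by auto
    show "complex_of_real (phi qp qm (Suc n) (fst p \<circ> flip n (snd p))) *
         (\<Prod>k\<in>pm (Suc n). cinner (u k) (?z ((fst p \<circ> flip n (snd p)) k))) =
       complex_of_real (flip_weight qp qm n (snd p) * phi qp qm n (fst p)) * (?c (snd p) * ?p (snd p) (fst p))"
      unfolding prod[OF p] phi_comp_flip[OF p] ..
  qed simp
  also have "\<dots> = (\<Sum>\<sigma>\<in>B_group n. \<Sum>i\<in>pm (Suc n). complex_of_real (flip_weight qp qm n i * phi qp qm n \<sigma>) *
         (?c i * ?p i \<sigma>))"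
    unfolding sum.cartesian_product by (simp only: case_prod_unfold)
  also have "\<dots> = free_inner n (annihilation_comp qp qm n x y (tens (Suc n) u)) (P_op qp qm n (tens n z))"
    by (simp add: annihilation_comp_tens P_op_tens free_inner_sum_left free_inner_left(2)[where F' = 0]
        free_inner_sum_right free_inner_right(2)[where G' = 0] free_inner_tens sum_distrib_left
        cinner_commute[symmetric] mult_ac)
  finally show ?thesis by simp
qed

text \<open>Both sides are linear in \<open>G\<close> and antilinear in \<open>F\<close>, so simple
  tensors suffice: first \<open>G\<close> varies against a simple tensor, then
  \<open>F\<close>.\<close>

lemma adjoint_comp:
  assumes F: "F \<in> tensor_power (Suc n)" and G: "G \<in> tensor_power n"
  shows "free_inner n (annihilation_comp qp qm n x y F) (P_op qp qm n G) =
     free_inner (Suc n) F (P_op qp qm (Suc n) (creation_comp n x y G))"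
proof -
  note lin = linear_kscaleD[OF linear_P_op] linear_kscaleD[OF linear_creation_comp]
    linear_kscaleD[OF linear_annihilation_comp]
  note mem = P_op_in_tensor_power creation_comp_in_tensor_power annihilation_comp_in_tensor_power
  have base: "free_inner n (annihilation_comp qp qm n x y (tens (Suc n) u)) (P_op qp qm n G) =
      free_inner (Suc n) (tens (Suc n) u) (P_op qp qm (Suc n) (creation_comp n x y G))" for u
    using G
  proof (induction rule: tensor_power_induct)
    case zero
    show ?case by (simp add: lin free_inner_right(3)[where G = 0 and G' = 0] mem)
  next
    case (step c z G)
    then show ?case
      by (simp add: lin free_inner_right(1) free_inner_right(2)[where G' = 0] mem adjoint_tens)
  qed
  show ?thesis
    using F
  proof (induction rule: tensor_power_induct)
    case zero
    show ?case using G by (simp add: lin free_inner_left(3)[where F = 0 and F' = 0] mem)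
  next
    case (step c u F)
    then show ?case
      using G by (simp add: lin free_inner_left(1) free_inner_left(2)[where F' = 0] mem base)
  qed
qed

section \<open>Adjoints on the Fock space\<close>

lemma fockD: "f \<in> fock \<Longrightarrow> f n \<in> tensor_power n" "f \<in> fock \<Longrightarrow> finite {n. f n \<noteq> 0}"
  by (auto simp: fock_def)

text \<open>Degrees in which one argument vanishes contribute 0. A freely chosen index set allows
  different products to be compared termwise.\<close>

lemma fock_inner_superset:
  assumes "f \<in> fock" "g \<in> fock" "finite A" "{n. f n \<noteq> 0 \<and> g n \<noteq> 0} \<subseteq> A"
  shows "fock_inner qp qm f g = (\<Sum>n\<in>A. free_inner n (f n) (P_op qp qm n (g n)))"
  unfolding fock_inner_def
proof (rule sum.mono_neutral_left[OF assms(3,4)], safe)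
  fix n assume "free_inner n (f n) (P_op qp qm n (g n)) \<noteq> 0" "g n = 0"
  then show False
    using free_inner_right(3)[where F = "f n" and n = n and G = 0 and G' = 0] fockD(1)[OF assms(1)]
    by (simp add: linear_kscaleD[OF linear_P_op])
next
  fix n assume "free_inner n (f n) (P_op qp qm n (g n)) \<noteq> 0"
  then show "f n = 0 \<Longrightarrow> False"
    using free_inner_left(3)[where G = "P_op qp qm n (g n)" and n = n and F = 0 and F' = 0]
      P_op_in_tensor_power[OF fockD(1)[OF assms(2)]]
    by simp
qed

lemma creation_in_fock:
  assumes "f \<in> fock"
  shows "creation x y f \<in> fock"
proof -
  have "creation x y f n \<in> tensor_power n" for n
    using fockD(1)[OF assms]
    by (cases n) (simp_all add: creation_0 creation_Suc creation_comp_in_tensor_power)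
  moreover have "{n. creation x y f n \<noteq> 0} \<subseteq> Suc ` {n. f n \<noteq> 0}"
  proof
    fix n assume "n \<in> {n. creation x y f n \<noteq> 0}"
    then show "n \<in> Suc ` {n. f n \<noteq> 0}"
      by (cases n) (auto simp: creation_0 creation_Suc linear_kscaleD[OF linear_creation_comp])
  qed
  ultimately show ?thesis
    using fockD(2)[OF assms] finite_surj unfolding fock_def by blast
qed

lemma vector_space_fscale: "vector_space fscale"
  by unfold_locales (auto simp: fscale_def kscale_def fun_eq_iff plus_fun_apply algebra_simps)

lemma linear_fscaleI:
  assumes "\<And>f g. T (f + g) = T f + T g" "\<And>c f. T (fscale c f) = fscale c (T f)"
  shows "Vector_Spaces.linear fscale fscale T"
  using assms
  by (simp add: Vector_Spaces.linear_def module_hom_def module_hom_axioms_def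
      module_iff_vector_space vector_space_fscale)

text \<open>Component \<open>n\<close> of the result is read from degree \<open>n+1\<close>, so the
  component of degree 0 is sent to 0.\<close>

definition annihilation_rep ::
  "real \<Rightarrow> real \<Rightarrow> 'a::real_inner cplx \<Rightarrow> 'a cplx \<Rightarrow> 'a graded \<Rightarrow> 'a graded" where
  "annihilation_rep qp qm x y f = (\<lambda>n. annihilation_comp qp qm n x y (f (Suc n)))"

lemma annihilation_rep_in_fock:
  assumes "f \<in> fock"
  shows "annihilation_rep qp qm x y f \<in> fock"
proof -
  have "{n. annihilation_rep qp qm x y f n \<noteq> 0} \<subseteq> Suc -` {n. f n \<noteq> 0}"
    by (auto simp: annihilation_rep_def linear_kscaleD[OF linear_annihilation_comp])
  moreover have "finite (Suc -` {n. f n \<noteq> 0})"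
    using fockD(2)[OF assms] inj_Suc by (rule finite_vimageI)
  ultimately have "finite {n. annihilation_rep qp qm x y f n \<noteq> 0}" by (rule finite_subset)
  then show ?thesis
    using fockD(1)[OF assms]
    by (simp add: fock_def annihilation_rep_def annihilation_comp_in_tensor_power)
qed

lemma is_adjoint_annihilation_rep:
  "is_adjoint qp qm (creation x y) (annihilation_rep qp qm x y)"
  unfolding is_adjoint_def
proof (intro conjI ballI)
  show "Vector_Spaces.linear fscale fscale (annihilation_rep qp qm x y)"
    by (rule linear_fscaleI)
      (auto simp: annihilation_rep_def fscale_def plus_fun_apply linear_kscaleD[OF linear_annihilation_comp])
  show "annihilation_rep qp qm x y f \<in> fock" if "f \<in> fock" for f
    using that by (rule annihilation_rep_in_fock)
  fix f g :: "'a graded"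
  assume f: "f \<in> fock" and g: "g \<in> fock"
  \<comment> \<open>The support of \<open>g\<close> indexes both sides:
    \<open>creation x y g\<close> lives only in the degrees \<open>n+1\<close> with
    \<open>g n \<noteq> 0\<close>.\<close>
  let ?A = "{n. g n \<noteq> 0}"
  have "fock_inner qp qm (annihilation_rep qp qm x y f) g =
      (\<Sum>n\<in>?A. free_inner n (annihilation_rep qp qm x y f n) (P_op qp qm n (g n)))"
    using f g fockD(2)[OF g] by (intro fock_inner_superset annihilation_rep_in_fock) auto
  also have "\<dots> = (\<Sum>n\<in>?A. free_inner (Suc n) (f (Suc n)) (P_op qp qm (Suc n) (creation x y g (Suc n))))"
    using fockD(1)[OF f] fockD(1)[OF g]
    by (simp add: annihilation_rep_def adjoint_comp creation_Suc)
  also have "\<dots> = (\<Sum>n\<in>Suc ` ?A. free_inner n (f n) (P_op qp qm n (creation x y g n)))"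
    by (simp add: sum.reindex)
  also have "\<dots> = fock_inner qp qm f (creation x y g)"
  proof (rule fock_inner_superset[symmetric, OF f creation_in_fock[OF g]])
    show "finite (Suc ` ?A)" using fockD(2)[OF g] by simp
    show "{n. f n \<noteq> 0 \<and> creation x y g n \<noteq> 0} \<subseteq> Suc ` ?A"
    proof
      fix n assume "n \<in> {n. f n \<noteq> 0 \<and> creation x y g n \<noteq> 0}"
      then show "n \<in> Suc ` ?A"
        by (cases n) (auto simp: creation_0 creation_Suc linear_kscaleD[OF linear_creation_comp])
    qed
  qed
  finally show "fock_inner qp qm (annihilation_rep qp qm x y f) g = fock_inner qp qm f (creation x y g)" .
qed

lemma fock_diff:
  assumes "f \<in> fock" "g \<in> fock"
  shows "f - g \<in> fock"
proof -
  have "{n. (f - g) n \<noteq> 0} \<subseteq> {n. f n \<noteq> 0} \<union> {n. g n \<noteq> 0}" by auto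
  then have "finite {n. (f - g) n \<noteq> 0}"
    by (rule finite_subset) (use fockD(2) assms in blast)
  then show ?thesis using assms fockD(1) by (simp add: fock_def)
qed

lemma fock_inner_diff_left:
  assumes "f \<in> fock" "f' \<in> fock" "g \<in> fock"
  shows "fock_inner qp qm (f - f') g = fock_inner qp qm f g - fock_inner qp qm f' g"
proof -
  have "fock_inner qp qm h g = (\<Sum>n | g n \<noteq> 0. free_inner n (h n) (P_op qp qm n (g n)))"
    if "h \<in> fock" for h
    by (rule fock_inner_superset[OF that assms(3) fockD(2)[OF assms(3)]]) auto
  then show ?thesis
    using assms
    by (simp add: fock_diff sum_subtractf[symmetric] free_inner_diff_left fockD(1)
        P_op_in_tensor_power)
qed

text \<open>With \<open>h = T f - T' f\<close>, the products of \<open>T f\<close> and of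
  \<open>T' f\<close> with \<open>h\<close> both equal that of \<open>f\<close> with
  \<open>S h\<close>. Their difference, the product of \<open>h\<close> with itself, is therefore
  0.\<close>

lemma adjoints_null_eq:
  assumes "is_adjoint qp qm S T" "is_adjoint qp qm S T'" "f \<in> fock"
  shows "null_eq qp qm (T f) (T' f)"
proof -
  have mem: "T f \<in> fock" "T' f \<in> fock" using assms by (auto simp: is_adjoint_def)
  let ?h = "T f - T' f"
  have h: "?h \<in> fock" using mem by (rule fock_diff)
  have "fock_inner qp qm (T f) ?h = fock_inner qp qm f (S ?h)"
    "fock_inner qp qm (T' f) ?h = fock_inner qp qm f (S ?h)"
    using assms h unfolding is_adjoint_def by blast+
  then show ?thesis unfolding null_eq_def by (simp add: fock_inner_diff_left[OF mem h])
qed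

text \<open>The explicit adjoint shows that the choice in \<open>annihilation\<close> is made among
  existing operators.\<close>

lemma is_adjoint_annihilation: "is_adjoint qp qm (creation x y) (annihilation qp qm x y)"
  unfolding annihilation_def
  by (rule someI[where P = "is_adjoint qp qm (creation x y)", OF is_adjoint_annihilation_rep])

section \<open>The commutation relation\<close>

lemma contract_creation_comp:
  assumes "F \<in> tensor_power n"
  shows "contract n x y (creation_comp n \<xi> \<eta> F) = kscale (cinner x \<xi> * cinner y \<eta>) F"
proof (rule linear_eq_on_tensor_power[where n = n, OF _ _ _ assms])
  show "Vector_Spaces.linear kscale kscale (\<lambda>F. contract n x y (creation_comp n \<xi> \<eta> F))"
    by (rule linear_kscaleI)
      (simp_all add: linear_kscaleD[OF linear_contract] linear_kscaleD[OF linear_creation_comp])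
  show "Vector_Spaces.linear kscale kscale (kscale (cinner x \<xi> * cinner y \<eta>))"
    by (rule linear_kscaleI) (simp_all add: K.scale_right_distrib mult_ac)
  fix z
  let ?z = "z(- int (Suc n) := \<xi>, int (Suc n) := \<eta>)"
  have "tens n ?z = tens n z" by (rule tens_cong) (auto dest: pm_neq_last)
  moreover have "- int (Suc n) \<noteq> int (Suc n)" by simp
  ultimately show "contract n x y (creation_comp n \<xi> \<eta> (tens n z)) = kscale (cinner x \<xi> * cinner y \<eta>) (tens n z)"
    by (simp add: creation_comp_tens contract_tens)
qed

text \<open>Splits the terms of \<open>beta_op\<close> by the sign of the index, to match the two
  sums in \<open>Gamma_op\<close>.\<close>

lemma sum_pm: "(\<Sum>i\<in>pm n. h i) = (\<Sum>i=1..int n. h i) + (\<Sum>i=1..int n. h (- i))"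
  for h :: "int \<Rightarrow> 'b::comm_monoid_add"
proof -
  have "pm n = {1..int n} \<union> uminus ` {1..int n}" unfolding pm_def by (auto simp: image_iff)
  moreover have "{1..int n} \<inter> uminus ` {1..int n} = {}" by auto
  ultimately have "(\<Sum>i\<in>pm n. h i) = (\<Sum>i=1..int n. h i) + (\<Sum>i\<in>uminus ` {1..int n}. h i)"
    by (simp add: sum.union_disjoint)
  also have "(\<Sum>i\<in>uminus ` {1..int n}. h i) = (\<Sum>i=1..int n. h (- i))"
    by (subst sum.reindex) auto
  finally show ?thesis .
qed

lemma tens_upd_cscale:
  assumes "i \<in> pm n"
  shows "tens n (z(- i := cscale c a, i := cscale d b)) = kscale (c * d) (tens n (z(- i := a, i := b)))"
  by (rule ext) (simp only: tens_upd2[OF assms] kscale_apply cinner_cscale_right mult_ac)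

text \<open>The transpositions carry the created entries \<open>\<xi>\<close> and
  \<open>\<eta>\<close> to the positions \<open>- i\<close> and \<open>i\<close>, while the old
  entries there are paired with \<open>x\<close> and \<open>y\<close>. Attaching these scalars to
  the new entries produces the two rank-one operators.\<close>

lemma beta_J_creation_tens:
  assumes i: "i \<in> pm n"
  shows "beta_J n x y i (creation_comp n \<xi> \<eta> (tens n z)) =
    tens n (z(- i := ketbra \<xi> x (z (- i)), i := ketbra \<eta> y (z i)))"
proof -
  let ?N = "int (Suc n)"
  let ?z = "z(- ?N := \<xi>, ?N := \<eta>)"
  have i': "- i \<in> pm n" using i by simp
  have ne: "i \<noteq> - i" using i by (auto simp: pm_def)
  note nN = pm_neq_last[OF i] pm_neq_last[OF i']
  have "tens n (?z \<circ> (Transposition.transpose i ?N \<circ> Transposition.transpose (- i) (- ?N))) =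
      tens n (z(- i := \<xi>, i := \<eta>))"
  proof (rule tens_cong)
    fix j assume "j \<in> pm n"
    note nj = pm_neq_last[OF this]
    show "(?z \<circ> (Transposition.transpose i ?N \<circ> Transposition.transpose (- i) (- ?N))) j =
        (z(- i := \<xi>, i := \<eta>)) j"
      using nj nN ne nN[symmetric] by (auto simp: Transposition.transpose_def)
  qed
  then show ?thesis
    unfolding creation_comp_tens beta_J_tens(2)[OF i] ketbra_def tens_upd_cscale[OF i]
    using nN by simp
qed

lemma Gamma_op_eq_beta_op:
  fixes x y \<xi> \<eta> :: "'a::real_inner cplx"
  assumes "f \<in> fock"
  shows "Gamma_op qp (ketbra \<xi> x) (ketbra \<eta> y) f = beta_op qp x y (creation \<xi> \<eta> f)"
proof (rule ext)
  fix n
  let ?\<beta> = "\<lambda>F. kscale (complex_of_real qp) (\<Sum>i\<in>pm n. beta_J n x y i F)"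
  have "Gamma_op qp (ketbra \<xi> x) (ketbra \<eta> y) f n = ?\<beta> (creation_comp n \<xi> \<eta> (f n))"
    unfolding Gamma_op_def
  proof (rule linear_eq_on_tensor_power[where n = n, OF Gamma_ext(1) _ _ fockD(1)[OF assms]])
    show "Vector_Spaces.linear kscale kscale (\<lambda>F. ?\<beta> (creation_comp n \<xi> \<eta> F))"
      by (rule linear_kscaleI)
        (simp_all only: linear_kscaleD[OF linear_beta_sum] linear_kscaleD[OF linear_creation_comp])
    \<comment> \<open>For a negative index the two updates come in the opposite order. Exchanging
      them gives the second sum of \<open>Gamma_op\<close>, with the operators swapped.\<close>
    have "(\<Sum>i=1..int n. tens n (z(i := ketbra \<xi> x (z i), - i := ketbra \<eta> y (z (- i))))) =
        (\<Sum>i=1..int n. tens n (z(- i := ketbra \<eta> y (z (- i)), i := ketbra \<xi> x (z i))))" for z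
      by (rule sum.cong) (auto intro!: arg_cong[where f = "tens n"] fun_upd_twist)
    then show "lin_ext n (\<lambda>z.
       kscale (complex_of_real qp) (\<Sum>i=1..int n. tens n (z(- i := ketbra \<xi> x (z (- i)), i := ketbra \<eta> y (z i)))) +
       kscale (complex_of_real qp) (\<Sum>i=1..int n. tens n (z(- i := ketbra \<eta> y (z (- i)), i := ketbra \<xi> x (z i))))) (tens n z)
       = ?\<beta> (creation_comp n \<xi> \<eta> (tens n z))" for z
      unfolding Gamma_ext(2) by (simp add: beta_J_creation_tens sum_pm K.scale_right_distrib
          cong: sum.cong)
  qed
  then show "Gamma_op qp (ketbra \<xi> x) (ketbra \<eta> y) f n = beta_op qp x y (creation \<xi> \<eta> f) n"
    by (simp add: beta_op_def creation_Suc)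
qed

text \<open>The plain contraction yields the first scalar, the flipped one the scalar with
  \<open>qm\<close>, and the remaining term is \<open>Gamma_op\<close>. For the explicit adjoint
  this is an equality of vectors, before any passage to the quotient.\<close>

lemma annihilation_rep_creation:
  assumes "f \<in> fock"
  shows "annihilation_rep qp qm x y (creation \<xi> \<eta> f) =
    fscale (cinner x \<xi> * cinner y \<eta>) f + fscale (complex_of_real qm * cinner x \<eta> * cinner y \<xi>) f
    + Gamma_op qp (ketbra \<xi> x) (ketbra \<eta> y) f"
  unfolding Gamma_op_eq_beta_op[OF assms]
  by (rule ext) (simp add: annihilation_rep_def annihilation_comp_def creation_Suc fscale_def beta_op_def plus_fun_apply
      contract_creation_comp[OF fockD(1)[OF assms]] mult_ac)

theorem theorem4p5:
  fixes x y \<xi> \<eta> :: "'a::{real_inner, polish_space} cplx" and qp qm :: real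
  assumes "(\<exists>(M::nat) (N::nat) \<epsilon>::real. M + N \<noteq> 0 \<and> \<epsilon> \<in> {1, -1} \<and>
              qp = \<epsilon> / (real M + real N) \<and> qm = (real M - real N) / (real M + real N))
           \<or> (qp = 0 \<and> -1 \<le> qm \<and> qm \<le> 1)"
  shows "(\<forall>f\<in>fock. null_eq qp qm
            (annihilation qp qm x y (creation \<xi> \<eta> f))
            (fscale (cinner x \<xi> * cinner y \<eta>) f
             + fscale (complex_of_real qm * cinner x \<eta> * cinner y \<xi>) f
             + Gamma_op qp (ketbra \<xi> x) (ketbra \<eta> y) f))
       \<and> (\<forall>f\<in>fock. Gamma_op qp (ketbra \<xi> x) (ketbra \<eta> y) f = beta_op qp x y (creation \<xi> \<eta> f))"
proof (intro conjI ballI)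
  fix f :: "'a graded"
  assume f: "f \<in> fock"
  show "Gamma_op qp (ketbra \<xi> x) (ketbra \<eta> y) f = beta_op qp x y (creation \<xi> \<eta> f)"
    using f by (rule Gamma_op_eq_beta_op)
  show "null_eq qp qm (annihilation qp qm x y (creation \<xi> \<eta> f))
     (fscale (cinner x \<xi> * cinner y \<eta>) f + fscale (complex_of_real qm * cinner x \<eta> * cinner y \<xi>) f
      + Gamma_op qp (ketbra \<xi> x) (ketbra \<eta> y) f)"
    \<comment> \<open>The chosen and the explicit adjoint agree up to a null vector on the created
      vector, and the explicit one satisfies the relation exactly.\<close>
    using adjoints_null_eq[OF is_adjoint_annihilation is_adjoint_annihilation_rep creation_in_fock[OF f]]
    unfolding annihilation_rep_creation[OF f] .
qed

end
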